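(* Let $\alpha$ be a fixed partition. Then, as formal power series in $t$, $$\frac{\sum_{n\geq0}F_{2n}^{\alpha}\,\frac{t^n}{n!}}{\sum_{n\geq0}F_{-2n}^{\alpha}\,\frac{(x^2y^2zt)^n}{n!}}=\exp\big((x+y)t\big).$$
   Context: Partitions are identified with Young diagrams (cell $(i,j)$ in row $i$, column $j$); for $\mu\subseteq\lambda$, $\lambda/\mu$ is the set of cells of $\lambda$ not in $\mu$, $\lambda/\mu\vdash n$ means it has $n$ cells. $v(\lambda/\mu),h(\lambda/\mu),d(\lambda/\mu)$ are the numbers of cells of $\lambda/\mu$ in even rows, in even columns, and in both even rows and even columns. A standard Young tableau (SYT) of shape $\lambda/\mu\vdash n$ is a bijection $T$ from its cells to $[n]$ with $T(i,j)\le T(i',j')$ whenever $i\le i',j\le j'$. Write $(i,j)\lhd(i',j')$ if $i<i'$ or ($i=i'$, $j<j'$). For an SYT $T$ of straight shape, ${\rm sign}(T)=(-1)^{\#\{(a,b):a\lhd b,\,T(a)>T(b)\}}$. For $T_1$ of shape $\nu/\mu\vdash k$ and $T_2$ of shape $\lambda/\nu$, $T_1\diamond T_2$ is the SYT of shape $\lambda/\mu$ equal to $T_1$ on $\nu/\mu$ and $T_2+k$ on $\lambda/\nu$. For $T$ of shape $\lambda/\mu$, ${\rm sign}(T)={\rm sign}(T_0){\rm sign}(T_0\diamond T)$ for any SYT $T_0$ of shape $\mu$ (independent of $T_0$), and $I_{\lambda/\mu}=\sum_T{\rm sign}(T)$ over SYTs of shape $\lambda/\mu$. For $n\ge0$: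 $F_{2n}^\alpha=\sum_{\lambda:\ \lambda/\alpha\vdash 2n}x^{v(\lambda/\alpha)}y^{h(\lambda/\alpha)}z^{d(\lambda/\alpha)}I_{\lambda/\alpha}$ and $F_{-2n}^\alpha=\sum_{\mu:\ \alpha/\mu\vdash 2n}(-x)^{-v(\alpha/\mu)}y^{-h(\alpha/\mu)}z^{-d(\alpha/\mu)}I_{\alpha/\mu}$. *)

theory Defs
  imports Complex_Main "HOL-Library.FuncSet"
    "HOL-Computational_Algebra.Formal_Power_Series"
begin

type_synonym cell = "nat \<times> nat"

definition is_partition :: "nat list \<Rightarrow> bool" where
  "is_partition lam \<longleftrightarrow> sorted_wrt (\<ge>) lam \<and> 0 \<notin> set lam"

text \<open>Rows and columns are numbered from 1, whereas list positions start at 0.\<close>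

definition young :: "nat list \<Rightarrow> cell set" where
  "young lam = {(i, j). 1 \<le> i \<and> i \<le> length lam \<and> 1 \<le> j \<and> j \<le> lam ! (i - 1)}"

definition skew :: "nat list \<Rightarrow> nat list \<Rightarrow> cell set" where
  "skew lam mu = young lam - young mu"

definition v_stat :: "cell set \<Rightarrow> nat" where
  "v_stat D = card {(i, j) \<in> D. even i}"

definition h_stat :: "cell set \<Rightarrow> nat" where
  "h_stat D = card {(i, j) \<in> D. even j}"

definition d_stat :: "cell set \<Rightarrow> nat" where
  "d_stat D = card {(i, j) \<in> D. even i \<and> even j}"

text \<open>Tableaux are extensional functions (\<open>undefined\<close> off the shape), so that each tableau
  is represented exactly once in sums.\<close>

definition SYT :: "cell set \<Rightarrow> (cell \<Rightarrow> nat) set" where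
  "SYT D = {T \<in> extensional D. bij_betw T D {1..card D} \<and>
     (\<forall>i j i' j'. (i, j) \<in> D \<longrightarrow> (i', j') \<in> D \<longrightarrow> i \<le> i' \<longrightarrow> j \<le> j' \<longrightarrow> T (i, j) \<le> T (i', j'))}"

definition cell_less :: "cell \<Rightarrow> cell \<Rightarrow> bool"  (infix "\<lhd>" 50) where
  "a \<lhd> b \<longleftrightarrow> fst a < fst b \<or> (fst a = fst b \<and> snd a < snd b)"

definition straight_sign :: "nat list \<Rightarrow> (cell \<Rightarrow> nat) \<Rightarrow> int" where
  "straight_sign lam T =
     (- 1) ^ card {(a, b). a \<in> young lam \<and> b \<in> young lam \<and> a \<lhd> b \<and> T a > T b}"

text \<open>\<open>diamond lam nu mu T1 T2\<close> glues \<open>T1\<close> of shape \<open>nu/mu\<close> and \<open>T2\<close> of shape \<open>lam/nu\<close>.\<close>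

definition diamond ::
  "nat list \<Rightarrow> nat list \<Rightarrow> nat list \<Rightarrow> (cell \<Rightarrow> nat) \<Rightarrow> (cell \<Rightarrow> nat) \<Rightarrow> (cell \<Rightarrow> nat)" where
  "diamond lam nu mu T1 T2 =
     restrict (\<lambda>c. if c \<in> skew nu mu then T1 c else T2 c + card (skew nu mu)) (skew lam mu)"

text \<open>The sign of a skew tableau, by means of an arbitrary tableau of the inner shape; the choice
  is immaterial by \<open>skew_sign_independent\<close> below.\<close>

definition skew_sign :: "nat list \<Rightarrow> nat list \<Rightarrow> (cell \<Rightarrow> nat) \<Rightarrow> int" where
  "skew_sign lam mu T =
     (let T0 = (SOME T0. T0 \<in> SYT (young mu))
      in straight_sign mu T0 * straight_sign lam (diamond lam mu [] T0 T))"

definition sign_imbalance :: "nat list \<Rightarrow> nat list \<Rightarrow> int" where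
  "sign_imbalance lam mu = (\<Sum>T\<in>SYT (skew lam mu). skew_sign lam mu T)"

definition F_plus :: "'a::field_char_0 \<Rightarrow> 'a \<Rightarrow> 'a \<Rightarrow> nat list \<Rightarrow> nat \<Rightarrow> 'a" where
  "F_plus x y z alpha m =
     (\<Sum>lam | is_partition lam \<and> young alpha \<subseteq> young lam \<and> card (skew lam alpha) = m.
        x ^ v_stat (skew lam alpha) * y ^ h_stat (skew lam alpha) * z ^ d_stat (skew lam alpha)
          * of_int (sign_imbalance lam alpha))"

definition F_minus :: "'a::field_char_0 \<Rightarrow> 'a \<Rightarrow> 'a \<Rightarrow> nat list \<Rightarrow> nat \<Rightarrow> 'a" where
  "F_minus x y z alpha m =
     (\<Sum>mu | is_partition mu \<and> young mu \<subseteq> young alpha \<and> card (skew alpha mu) = m.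
        (- x) powi (- int (v_stat (skew alpha mu))) * y powi (- int (h_stat (skew alpha mu)))
          * z powi (- int (d_stat (skew alpha mu))) * of_int (sign_imbalance alpha mu))"

lemma finite_young: "finite (young lam)"
proof (rule finite_subset)
  show "young lam \<subseteq> {..length lam} \<times> {..sum_list lam}"
  proof
    fix c assume "c \<in> young lam"
    then obtain i j where c: "c = (i, j)" "1 \<le> i" "i \<le> length lam" "j \<le> lam ! (i - 1)"
      by (auto simp: young_def)
    then have "lam ! (i - 1) \<in> set lam" by simp
    then have "lam ! (i - 1) \<le> sum_list lam" by (simp add: member_le_sum_list)
    with c show "c \<in> {..length lam} \<times> {..sum_list lam}" by simp
  qed
qed simp

lemma straight_sign_diamond:
  assumes sub: "young mu \<subseteq> young lam" and T0: "T0 \<in> SYT (young mu)" and T: "T \<in> SYT (skew lam mu)"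
  shows "straight_sign mu T0 * straight_sign lam (diamond lam mu [] T0 T) =
    (- 1) ^ card ({(a, b). a \<in> skew lam mu \<and> b \<in> skew lam mu \<and> a \<lhd> b \<and> T a > T b} \<union>
      {(a, b). a \<in> skew lam mu \<and> b \<in> young mu \<and> a \<lhd> b})"
proof -
  define U where "U = diamond lam mu [] T0 T"
  define A where "A = {(a, b). a \<in> young mu \<and> b \<in> young mu \<and> a \<lhd> b \<and> T0 a > T0 b}"
  define B where "B = {(a, b). a \<in> skew lam mu \<and> b \<in> skew lam mu \<and> a \<lhd> b \<and> T a > T b} \<union>
      {(a, b). a \<in> skew lam mu \<and> b \<in> young mu \<and> a \<lhd> b}"
  have empty: "skew nu [] = young nu" for nu
    by (auto simp: skew_def young_def)
  have Uin: "U c = T0 c" if "c \<in> young mu" for c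
    using that sub by (auto simp: U_def diamond_def empty)
  have Uout: "U c = T c + card (young mu)" if "c \<in> skew lam mu" for c
    using that by (auto simp: U_def diamond_def empty) (auto simp: skew_def)
  have le: "T0 c \<le> card (young mu)" if "c \<in> young mu" for c
    using T0 that by (auto simp: SYT_def bij_betw_def)
  have ge: "1 \<le> T c" if "c \<in> skew lam mu" for c
  proof -
    have "T c \<in> {1..card (skew lam mu)}"
      using T that by (auto simp: SYT_def bij_betw_def)
    then show ?thesis by simp
  qed
  have lam: "c \<in> young lam \<longleftrightarrow> c \<in> young mu \<or> c \<in> skew lam mu" for c
    using sub by (auto simp: skew_def)
  have inv: "a \<in> young lam \<and> b \<in> young lam \<and> a \<lhd> b \<and> U a > U b \<longleftrightarrow> (a, b) \<in> A \<union> B" for a b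
  proof -
    have disj: "c \<in> young mu \<Longrightarrow> c \<notin> skew lam mu" for c by (simp add: skew_def)
    consider "a \<in> young mu" "b \<in> young mu" | "a \<in> young mu" "b \<in> skew lam mu"
      | "a \<in> skew lam mu" "b \<in> young mu" | "a \<in> skew lam mu" "b \<in> skew lam mu"
      | "a \<notin> young lam \<or> b \<notin> young lam"
      using lam by blast
    then show ?thesis
    proof cases
      case 1 then show ?thesis using disj[of a] disj[of b] by (auto simp: A_def B_def Uin lam)
    next
      case 2 then show ?thesis using disj[of a] disj[of b] le[of a] by (auto simp: A_def B_def Uin Uout lam)
    next
      case 3 then show ?thesis using disj[of a] disj[of b] le[of b] ge[of a] by (auto simp: A_def B_def Uin Uout lam)
    next
      case 4 then show ?thesis using disj[of a] disj[of b] by (auto simp: A_def B_def Uout lam)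
    next
      case 5 then show ?thesis by (auto simp: A_def B_def lam)
    qed
  qed
  have "A \<subseteq> young mu \<times> young mu" by (auto simp: A_def)
  then have finA: "finite A" using finite_young finite_subset by blast
  have "B \<subseteq> young lam \<times> young lam" using sub by (auto simp: B_def skew_def)
  then have finB: "finite B" using finite_young finite_subset by blast
  have "A \<inter> B = {}" by (auto simp: A_def B_def skew_def)
  then have "card (A \<union> B) = card A + card B" using finA finB by (rule card_Un_disjoint[rotated 2])
  moreover have "{(a, b). a \<in> young lam \<and> b \<in> young lam \<and> a \<lhd> b \<and> U a > U b} = A \<union> B"
    using inv by auto
  ultimately have "straight_sign lam U = (- 1) ^ (card A + card B)"
    by (simp add: straight_sign_def)
  moreover have "straight_sign mu T0 = (- 1) ^ card A"
    by (simp add: straight_sign_def A_def)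
  ultimately have "straight_sign mu T0 * straight_sign lam U = (- 1) ^ card B"
    by (simp add: power_add flip: mult.assoc power_mult_distrib)
  then show ?thesis by (simp add: U_def B_def)
qed

lemma skew_sign_independent:
  assumes "young mu \<subseteq> young lam" "T0 \<in> SYT (young mu)" "T \<in> SYT (skew lam mu)"
  shows "skew_sign lam mu T = straight_sign mu T0 * straight_sign lam (diamond lam mu [] T0 T)"
proof -
  have "(SOME T0. T0 \<in> SYT (young mu)) \<in> SYT (young mu)"
    using assms(2) by (rule someI[where P = "\<lambda>T0. T0 \<in> SYT (young mu)"])
  then show ?thesis
    using straight_sign_diamond[OF assms(1) _ assms(3)] assms(2) by (simp add: skew_sign_def Let_def)
qed

end

theory Submission
  imports Defs
begin

text \<open>On functions of Young diagrams let \<open>U\<close> (\<open>D\<close>) sum over all ways of adding (removing) one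
  cell \<open>c\<close>, with the sign given by the number of cells after \<open>c\<close> in reading order and with the
  weights of \<open>c\<close> occurring in \<open>F_plus\<close> (\<open>F_minus\<close>). Deleting the smallest or the largest entry of
  a tableau gives \<open>F_plus = U\<^sup>m 1\<close> and \<open>F_minus = D\<^sup>m 1\<close>. The signs make operations at different
  corners anticommute, and the product of the two weights of a cell in row \<open>i\<close> is \<open>(-1)\<^bsup>i+1\<^esup>\<close>; since
  the rows with an addable corner are row 1 and the rows below those with a removable one,
  \<open>UD + DU = 1\<close>, so that \<open>U\<^sup>2\<close> commutes with \<open>D\<close>. In \<open>U\<^sup>2 1\<close> and \<open>D\<^sup>2 1\<close> all pairs of cells cancel except
  dominoes. Horizontal dominoes telescope over the rows and vertical ones over the columns, whence
  \<open>U\<^sup>2 1 = x\<^sup>2y\<^sup>2z D\<^sup>2 1 + (x + y)\<close>. By commutation \<open>U\<^bsup>2n\<^esup> 1 = (x\<^sup>2y\<^sup>2z D\<^sup>2 + (x + y))\<^sup>n 1\<close>, which is the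
  theorem.\<close>

subsection \<open>Young diagrams as sets of cells\<close>

text \<open>Sets of cells are used instead of lists: adding or removing a cell becomes
  \<open>insert\<close> or set difference, and transposition is the image under
  \<open>prod.swap\<close>, so that statements about columns follow from those about rows.\<close>

definition diagram :: "cell set \<Rightarrow> bool" where
  "diagram S \<longleftrightarrow> finite S \<and> S \<subseteq> {1..} \<times> {1..} \<and>
     (\<forall>i j i' j'. (i', j') \<in> S \<longrightarrow> 1 \<le> i \<longrightarrow> i \<le> i' \<longrightarrow> 1 \<le> j \<longrightarrow> j \<le> j' \<longrightarrow> (i, j) \<in> S)"

lemma diagramD:
  assumes "diagram S" "(i', j') \<in> S" "1 \<le> i" "i \<le> i'" "1 \<le> j" "j \<le> j'"
  shows "(i, j) \<in> S"
  using assms unfolding diagram_def by blast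

lemma diagram_finite: "diagram S \<Longrightarrow> finite S"
  by (simp add: diagram_def)

lemma diagram_pos: "diagram S \<Longrightarrow> (i, j) \<in> S \<Longrightarrow> 1 \<le> i \<and> 1 \<le> j"
  by (auto simp: diagram_def)

lemma diagram_empty: "diagram {}"
  by (simp add: diagram_def)

lemma diagram_Un: "diagram S \<Longrightarrow> diagram T \<Longrightarrow> diagram (S \<union> T)"
  unfolding diagram_def by blast

lemma diagram_Int:
  assumes "diagram S" "diagram T" shows "diagram (S \<inter> T)"
  unfolding diagram_def
proof (intro conjI allI impI)
  show "(i, j) \<in> S \<inter> T"
    if "(i', j') \<in> S \<inter> T" "1 \<le> i" "i \<le> i'" "1 \<le> j" "j \<le> j'" for i j i' j'
    using that diagramD[OF assms(1), of i' j' i j] diagramD[OF assms(2), of i' j' i j] by blast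
qed (use assms in \<open>auto simp: diagram_def\<close>)

lemma diagram_swap:
  assumes "diagram S" shows "diagram (prod.swap ` S)"
  unfolding diagram_def
proof (intro conjI allI impI)
  have mem: "(i, j) \<in> prod.swap ` S \<longleftrightarrow> (j, i) \<in> S" for i j by force
  show "finite (prod.swap ` S)" using diagram_finite[OF assms] by simp
  show "prod.swap ` S \<subseteq> {1..} \<times> {1..}" using diagram_pos[OF assms] by force
  show "(i, j) \<in> prod.swap ` S"
    if "(i', j') \<in> prod.swap ` S" "1 \<le> i" "i \<le> i'" "1 \<le> j" "j \<le> j'" for i j i' j'
    using diagramD[OF assms, of j' i' j i] that unfolding mem by blast
qed

lemma diagram_swap_iff: "diagram (prod.swap ` S) \<longleftrightarrow> diagram S"
  using diagram_swap[of S] diagram_swap[of "prod.swap ` S"] by (auto simp: image_image)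

section \<open>Row lengths and horizontal strips\<close>

definition row_len :: "cell set \<Rightarrow> nat \<Rightarrow> nat" where
  "row_len S i = card {j. (i, j) \<in> S}"

lemma down_closed_nat_set_eq:
  fixes A :: "nat set"
  assumes "finite A" "\<And>j. j \<in> A \<Longrightarrow> 1 \<le> j" "\<And>j j'. j' \<in> A \<Longrightarrow> 1 \<le> j \<Longrightarrow> j \<le> j' \<Longrightarrow> j \<in> A"
  shows "A = {1..card A}"
proof (cases "A = {}")
  case False
  have "A = {1..Max A}"
  proof (intro set_eqI iffI)
    show "j \<in> {1..Max A}" if "j \<in> A" for j using that assms(1,2) by simp
    show "j \<in> A" if "j \<in> {1..Max A}" for j
      using that assms(3)[of "Max A" j] Max_in[OF assms(1) False] by simp
  qed
  moreover from this have "card A = Max A"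
    by (metis card_atLeastAtMost diff_Suc_1)
  ultimately show ?thesis by simp
qed simp

text \<open>Down-closure makes each row an initial segment, so the row lengths determine the
  diagram. Row 0 is empty and has length 0.\<close>

lemma mem_diagram_iff:
  assumes "diagram S"
  shows "(i, j) \<in> S \<longleftrightarrow> 1 \<le> i \<and> 1 \<le> j \<and> j \<le> row_len S i"
proof (cases "1 \<le> i")
  case True
  have "{j. (i, j) \<in> S} = snd ` (S \<inter> {i} \<times> UNIV)"
    by force
  then have "finite {j. (i, j) \<in> S}"
    using diagram_finite[OF assms] by simp
  then have "{j. (i, j) \<in> S} = {1..row_len S i}"
    unfolding row_len_def
  proof (rule down_closed_nat_set_eq)
    show "1 \<le> j" if "j \<in> {j. (i, j) \<in> S}" for j using that diagram_pos[OF assms] by blast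
    show "j \<in> {j. (i, j) \<in> S}" if "j' \<in> {j. (i, j) \<in> S}" "1 \<le> j" "j \<le> j'" for j j'
      using that True diagramD[OF assms, of i j' i j] by simp
  qed
  then show ?thesis using True by auto
next
  case False
  then show ?thesis using diagram_pos[OF assms] by blast
qed

lemma row_len_antimono:
  assumes "diagram S" "1 \<le> i" "i \<le> i'"
  shows "row_len S i' \<le> row_len S i"
proof (cases "row_len S i' = 0")
  case False
  then have "(i', row_len S i') \<in> S" using mem_diagram_iff[OF assms(1), of i' "row_len S i'"] assms by auto
  then have "(i, row_len S i') \<in> S" using diagramD[OF assms(1), of i' "row_len S i'" i "row_len S i'"] False assms by auto
  then show ?thesis using mem_diagram_iff[OF assms(1), of i "row_len S i'"] by blast
qed simp

text \<open>The cell \<open>c\<close> is the left end. Length 1 gives corners and length 2 gives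
  horizontal dominoes, so both are treated by one argument.\<close>

definition row_strip :: "nat \<Rightarrow> cell \<Rightarrow> cell set" where
  "row_strip k c = {fst c} \<times> {snd c..<snd c + k}"

definition strips_add :: "nat \<Rightarrow> cell set \<Rightarrow> cell set" where
  "strips_add k S = {c. row_strip k c \<inter> S = {} \<and> diagram (S \<union> row_strip k c)}"

definition strips_rem :: "nat \<Rightarrow> cell set \<Rightarrow> cell set" where
  "strips_rem k S = {c. row_strip k c \<subseteq> S \<and> diagram (S - row_strip k c)}"

text \<open>The strip must continue its row without a gap, and the row above must cover it. Row 1
  has a disjunct of its own: nothing lies above it, yet \<open>row_len S (1 - 1)\<close> is
  0.\<close>

lemma strips_add_eq:
  assumes S: "diagram S" and k: "1 \<le> k"
  shows "strips_add k S =
    (\<lambda>i. (i, Suc (row_len S i))) ` {i. 1 \<le> i \<and> (i = 1 \<or> row_len S i + k \<le> row_len S (i - 1))}"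
    (is "_ = ?f ` ?I")
proof (intro set_eqI iffI)
  fix c assume c: "c \<in> strips_add k S"
  obtain i j where ij: "c = (i, j)" by (cases c)
  let ?T = "S \<union> row_strip k c"
  have T: "diagram ?T" and dj: "row_strip k c \<inter> S = {}" using c by (auto simp: strips_add_def)
  have mem: "(i, j') \<in> ?T" "(i, j') \<notin> S" if "j \<le> j'" "j' < j + k" for j'
  proof -
    have "(i, j') \<in> row_strip k c" using that by (simp add: row_strip_def ij)
    then show "(i, j') \<in> ?T" "(i, j') \<notin> S" using dj by blast+
  qed
  have pos: "1 \<le> i" "1 \<le> j" using diagram_pos[OF T mem(1)[of j]] k by auto
  have gt: "row_len S i < j" using mem(2)[of j] k pos by (auto simp: mem_diagram_iff[OF S])
  \<comment> \<open>No gap can occur: the left neighbour of the strip lies in the enlarged diagram,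
    hence already in \<open>S\<close>.\<close>
  have "j \<le> Suc (row_len S i)"
  proof (rule ccontr)
    assume big: "\<not> j \<le> Suc (row_len S i)"
    then have "(i, j - 1) \<in> ?T" using diagramD[OF T mem(1)[of j], of i "j - 1"] pos k by auto
    then have "(i, j - 1) \<in> S" using big by (auto simp: row_strip_def ij)
    then show False using big by (auto simp: mem_diagram_iff[OF S])
  qed
  with gt have j: "j = Suc (row_len S i)" by simp
  have "row_len S i + k \<le> row_len S (i - 1)" if "i \<noteq> 1"
  proof -
    have "(i - 1, row_len S i + k) \<in> ?T"
      using diagramD[OF T mem(1)[of "row_len S i + k"], of "i - 1" "row_len S i + k"] pos that j k by auto
    then have "(i - 1, row_len S i + k) \<in> S" using pos by (auto simp: row_strip_def ij)
    then show ?thesis by (simp add: mem_diagram_iff[OF S])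
  qed
  then show "c \<in> ?f ` ?I" using pos j ij by auto
next
  fix c assume "c \<in> ?f ` ?I"
  then obtain i where i: "c = (i, Suc (row_len S i))" "1 \<le> i" "i = 1 \<or> row_len S i + k \<le> row_len S (i - 1)"
    by auto
  let ?T = "S \<union> row_strip k c"
  have mem: "(a, b) \<in> ?T \<longleftrightarrow> 1 \<le> a \<and> 1 \<le> b \<and> b \<le> (if a = i then row_len S i + k else row_len S a)" for a b
    using i by (auto simp: mem_diagram_iff[OF S] row_strip_def)
  have mono: "(if a' = i then row_len S i + k else row_len S a') \<le> (if a = i then row_len S i + k else row_len S a)"
    if "1 \<le> a" "a \<le> a'" for a a'
  proof (cases "a = a'")
    case False
    have "row_len S (i - 1) \<le> row_len S a" if "a < i"
      using row_len_antimono[OF S, of a "i - 1"] that \<open>1 \<le> a\<close> by simp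
    then show ?thesis
      using False that i row_len_antimono[OF S, of a a'] by auto
  qed simp
  have "diagram ?T"
    unfolding diagram_def
  proof (intro conjI allI impI)
    show "finite ?T" using diagram_finite[OF S] by (simp add: row_strip_def)
    show "?T \<subseteq> {1..} \<times> {1..}" using mem by auto
    show "(a, b) \<in> ?T" if "(a', b') \<in> ?T" "1 \<le> a" "a \<le> a'" "1 \<le> b" "b \<le> b'" for a b a' b'
      using that mono[of a a'] unfolding mem by linarith
  qed
  moreover have "row_strip k c \<inter> S = {}" using i by (auto simp: row_strip_def mem_diagram_iff[OF S])
  ultimately show "c \<in> strips_add k S" by (simp add: strips_add_def)
qed

text \<open>The strip must be the end of its row, and the row below must not reach under it. The
  subtraction of \<open>k\<close> is never truncated, as the condition gives
  \<open>k \<le> row_len S i\<close>.\<close>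

lemma strips_rem_eq:
  assumes S: "diagram S" and k: "1 \<le> k"
  shows "strips_rem k S =
    (\<lambda>i. (i, Suc (row_len S i) - k)) ` {i. 1 \<le> i \<and> row_len S (Suc i) + k \<le> row_len S i}"
    (is "_ = ?f ` ?I")
proof (intro set_eqI iffI)
  fix c assume c: "c \<in> strips_rem k S"
  obtain i j where ij: "c = (i, j)" by (cases c)
  let ?T = "S - row_strip k c"
  have T: "diagram ?T" and sub: "row_strip k c \<subseteq> S" using c by (auto simp: strips_rem_def)
  have mem: "(i, j') \<in> S" if "j \<le> j'" "j' < j + k" for j'
    using that sub by (auto simp: row_strip_def ij)
  have pos: "1 \<le> i" "1 \<le> j" using diagram_pos[OF S mem[of j]] k by auto
  have le: "j + k \<le> Suc (row_len S i)" using mem[of "j + k - 1"] k mem_diagram_iff[OF S, of i "j + k - 1"] by linarith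
  have "\<not> j + k \<le> row_len S i"
  proof
    assume "j + k \<le> row_len S i"
    then have "(i, j + k) \<in> ?T" using pos by (auto simp: mem_diagram_iff[OF S] row_strip_def ij)
    then have "(i, j) \<in> ?T" using diagramD[OF T, of i "j + k" i j] pos by auto
    then show False using k by (auto simp: row_strip_def ij)
  qed
  with le have j: "j + k = Suc (row_len S i)" by simp
  have "\<not> j \<le> row_len S (Suc i)"
  proof
    assume "j \<le> row_len S (Suc i)"
    then have "(Suc i, j) \<in> ?T" using pos by (auto simp: mem_diagram_iff[OF S] row_strip_def ij)
    then have "(i, j) \<in> ?T" using diagramD[OF T, of "Suc i" j i j] pos by auto
    then show False using k by (auto simp: row_strip_def ij)
  qed
  then have "row_len S (Suc i) + k \<le> row_len S i" using j by simp
  then show "c \<in> ?f ` ?I" using pos j ij by (intro image_eqI[of _ _ i]) auto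
next
  fix c assume "c \<in> ?f ` ?I"
  then obtain i where i: "c = (i, Suc (row_len S i) - k)" "1 \<le> i" "row_len S (Suc i) + k \<le> row_len S i"
    by auto
  let ?T = "S - row_strip k c"
  have mem: "(a, b) \<in> ?T \<longleftrightarrow> 1 \<le> a \<and> 1 \<le> b \<and> b \<le> (if a = i then row_len S i - k else row_len S a)" for a b
    using i by (auto simp: mem_diagram_iff[OF S] row_strip_def)
  have mono: "(if a' = i then row_len S i - k else row_len S a') \<le> (if a = i then row_len S i - k else row_len S a)"
    if "1 \<le> a" "a \<le> a'" for a a'
  proof (cases "a = a'")
    case False
    then show ?thesis
      using that i row_len_antimono[OF S, of a a'] row_len_antimono[OF S, of "Suc i" a'] by auto
  qed simp
  have "diagram ?T"
    unfolding diagram_def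
  proof (intro conjI allI impI)
    show "finite ?T" using diagram_finite[OF S] by simp
    show "?T \<subseteq> {1..} \<times> {1..}" using mem by auto
    show "(a, b) \<in> ?T" if "(a', b') \<in> ?T" "1 \<le> a" "a \<le> a'" "1 \<le> b" "b \<le> b'" for a b a' b'
      using that mono[of a a'] unfolding mem by linarith
  qed
  moreover have "row_strip k c \<subseteq> S" using i by (auto simp: row_strip_def mem_diagram_iff[OF S])
  ultimately show "c \<in> strips_rem k S" by (simp add: strips_rem_def)
qed

lemma finite_strips_rem:
  assumes "diagram S" "1 \<le> k" shows "finite (strips_rem k S)"
proof (rule finite_subset)
  show "strips_rem k S \<subseteq> S" using assms(2) by (force simp: strips_rem_def row_strip_def)
qed (rule diagram_finite[OF assms(1)])

text \<open>The inequality that lets a strip be added to row \<open>Suc i\<close> is the one that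
  lets a strip be removed from row \<open>i\<close>; row 1 is the only extra place.\<close>

lemma strip_rows_add_eq:
  assumes "1 \<le> k"
  shows "{i. 1 \<le> i \<and> (i = 1 \<or> row_len S i + k \<le> row_len S (i - 1))} =
    insert 1 (Suc ` {i. 1 \<le> i \<and> row_len S (Suc i) + k \<le> row_len S i})" (is "?A = insert 1 (Suc ` ?R)")
proof (intro set_eqI iffI)
  fix i assume i: "i \<in> ?A"
  show "i \<in> insert 1 (Suc ` ?R)"
  proof (cases "i = 1")
    case False
    then have "i = Suc (i - 1)" "i - 1 \<in> ?R" using i by auto
    then show ?thesis by blast
  qed simp
qed auto

lemma finite_strip_rows:
  assumes "diagram S" "1 \<le> k"
  shows "finite {i. 1 \<le> i \<and> row_len S (Suc i) + k \<le> row_len S i}" (is "finite ?R")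
proof -
  have "?R \<subseteq> fst ` strips_rem k S"
    unfolding strips_rem_eq[OF assms] by force
  then show ?thesis using finite_strips_rem[OF assms] finite_subset by blast
qed

lemma finite_strips_add: "diagram S \<Longrightarrow> 1 \<le> k \<Longrightarrow> finite (strips_add k S)"
  using finite_strip_rows[of S k] unfolding strips_add_eq strip_rows_add_eq by blast

text \<open>Each row has at most one such strip, so sums over strips are sums over rows, and
  \<open>strip_rows_add_eq\<close> shifts them by one row. This is the telescoping used for corners
  (\<open>k = 1\<close>) and for dominoes (\<open>k = 2\<close>).\<close>

lemma sum_strips_add:
  fixes f :: "nat \<Rightarrow> 'b::comm_monoid_add"
  assumes "diagram S" "1 \<le> k"
  shows "(\<Sum>c\<in>strips_add k S. f (fst c)) = f 1 + (\<Sum>c\<in>strips_rem k S. f (Suc (fst c)))"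
proof -
  let ?R = "{i. 1 \<le> i \<and> row_len S (Suc i) + k \<le> row_len S i}"
  have fin: "finite ?R" using assms by (rule finite_strip_rows)
  have "(\<Sum>c\<in>strips_add k S. f (fst c)) = (\<Sum>i\<in>insert 1 (Suc ` ?R). f i)"
    unfolding strips_add_eq[OF assms] strip_rows_add_eq[OF assms(2)]
    by (subst sum.reindex) (auto simp: inj_on_def)
  also have "\<dots> = f 1 + (\<Sum>i\<in>?R. f (Suc i))"
    using fin by (subst sum.insert) (auto simp: sum.reindex)
  also have "(\<Sum>i\<in>?R. f (Suc i)) = (\<Sum>c\<in>strips_rem k S. f (Suc (fst c)))"
    unfolding strips_rem_eq[OF assms]
    by (subst sum.reindex) (auto simp: inj_on_def)
  finally show ?thesis .
qed

section \<open>Addable and removable corners\<close>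

definition addable :: "cell set \<Rightarrow> cell set" where
  "addable S = {c. c \<notin> S \<and> diagram (insert c S)}"

definition removable :: "cell set \<Rightarrow> cell set" where
  "removable S = {c \<in> S. diagram (S - {c})}"

lemma row_strip_1: "row_strip 1 c = {c}"
  by (cases c) (auto simp: row_strip_def)

lemma addable_eq_strips: "addable S = strips_add 1 S"
  unfolding addable_def strips_add_def row_strip_1 by simp

lemma removable_eq_strips: "removable S = strips_rem 1 S"
  unfolding removable_def strips_rem_def row_strip_1 by auto

lemma finite_addable: "diagram S \<Longrightarrow> finite (addable S)"
  by (simp add: addable_eq_strips finite_strips_add)

lemma finite_removable: "diagram S \<Longrightarrow> finite (removable S)"
  by (simp add: removable_eq_strips finite_strips_rem)

text \<open>A cell with the largest coordinate sum has no other cell to its lower right, so it can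
  be removed.\<close>

lemma removable_nonempty:
  assumes S: "diagram S" "S \<noteq> {}"
  shows "removable S \<noteq> {}"
proof -
  have fin: "finite S" using S(1) by (rule diagram_finite)
  have "Max ((\<lambda>d. fst d + snd d) ` S) \<in> (\<lambda>d. fst d + snd d) ` S"
    using fin S(2) by (intro Max_in) auto
  then obtain c where c: "c \<in> S" "fst c + snd c = Max ((\<lambda>d. fst d + snd d) ` S)" by auto
  have max: "fst d + snd d \<le> fst c + snd c" if "d \<in> S" for d
    unfolding c(2) using fin that by (intro Max_ge) auto
  have "(i, j) \<in> S - {c}"
    if "(i', j') \<in> S - {c}" "1 \<le> i" "i \<le> i'" "1 \<le> j" "j \<le> j'" for i j i' j'
    using diagramD[OF S(1), of i' j' i j] max[of "(i', j')"] that by auto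
  moreover have "finite (S - {c})" "S - {c} \<subseteq> {1..} \<times> {1..}" using S(1) by (auto simp: diagram_def)
  ultimately have "diagram (S - {c})" unfolding diagram_def by blast
  then show ?thesis using c(1) unfolding removable_def by blast
qed

text \<open>The rectangle spanned by a cell \<open>(i, j)\<close> lies in \<open>S\<close>, so
  \<open>i * j\<close> is at most \<open>card S\<close>. It follows that only finitely many diagrams
  have a given number of cells.\<close>

lemma diagram_subset_square:
  assumes "diagram S" shows "S \<subseteq> {..card S} \<times> {..card S}"
proof
  fix c assume c: "c \<in> S"
  obtain i j where ij: "c = (i, j)" by (cases c)
  have pos: "1 \<le> i" "1 \<le> j" using diagram_pos[OF assms] c ij by auto
  have "{1..i} \<times> {1..j} \<subseteq> S" using c ij diagramD[OF assms, of i j] by auto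
  then have "card ({1..i} \<times> {1..j}) \<le> card S" by (rule card_mono[OF diagram_finite[OF assms]])
  then have "i * j \<le> card S" by (simp add: card_cartesian_product)
  moreover have "i \<le> i * j" "j \<le> i * j" using pos by auto
  ultimately show "c \<in> {..card S} \<times> {..card S}" unfolding ij by (simp only: mem_Times_iff fst_conv snd_conv atMost_iff) linarith
qed

lemma finite_diagrams_of_card: "finite {S. diagram S \<and> card S = n}"
proof (rule finite_subset)
  show "{S. diagram S \<and> card S = n} \<subseteq> Pow ({..n} \<times> {..n})"
    using diagram_subset_square by blast
qed simp

section \<open>Correspondence between partitions and diagrams\<close>

lemma mem_young: "(i, j) \<in> young lam \<longleftrightarrow> 1 \<le> i \<and> i \<le> length lam \<and> 1 \<le> j \<and> j \<le> lam ! (i - 1)"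
  by (simp add: young_def)

lemma diagram_young:
  assumes "is_partition lam" shows "diagram (young lam)"
proof -
  have mono: "lam ! b \<le> lam ! a" if "a \<le> b" "b < length lam" for a b
    using assms that by (cases "a = b") (auto simp: is_partition_def sorted_wrt_iff_nth_less)
  have "(i, j) \<in> young lam"
    if "(i', j') \<in> young lam" "1 \<le> i" "i \<le> i'" "1 \<le> j" "j \<le> j'" for i j i' j'
  proof -
    have "lam ! (i' - 1) \<le> lam ! (i - 1)" using that by (intro mono) (auto simp: mem_young)
    then show ?thesis using that by (auto simp: mem_young)
  qed
  then show ?thesis
    unfolding diagram_def using finite_young by (auto simp: young_def)
qed

lemma row_len_young:
  assumes "is_partition lam" "1 \<le> i" "i \<le> length lam"
  shows "row_len (young lam) i = lam ! (i - 1)"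
proof -
  have "{j. (i, j) \<in> young lam} = {1..lam ! (i - 1)}" using assms by (auto simp: mem_young)
  then show ?thesis by (simp add: row_len_def)
qed

text \<open>No part is 0, so the first column has one cell for each part and recovers the length;
  the row lengths recover the parts.\<close>

lemma young_inj:
  assumes "is_partition lam" "is_partition mu" "young lam = young mu"
  shows "lam = mu"
proof -
  have "{i. (i, 1) \<in> young nu} = {1..length nu}" if "is_partition nu" for nu
  proof -
    have "1 \<le> nu ! (i - 1)" if "1 \<le> i" "i \<le> length nu" for i
    proof -
      have "nu ! (i - 1) \<in> set nu" using that by simp
      then have "nu ! (i - 1) \<noteq> 0" using \<open>is_partition nu\<close> unfolding is_partition_def by metis
      then show ?thesis by simp
    qed
    then show ?thesis by (auto simp: mem_young)
  qed
  then have "{1..length lam} = {1..length mu}" using assms by metis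
  then have len: "length lam = length mu" by (metis card_atLeastAtMost diff_Suc_1)
  moreover have "lam ! k = mu ! k" if "k < length lam" for k
    using row_len_young[OF assms(1), of "Suc k"] row_len_young[OF assms(2), of "Suc k"] that len assms(3)
    by simp
  ultimately show ?thesis by (rule nth_equalityI)
qed

lemma young_surj:
  assumes "diagram S" shows "\<exists>lam. is_partition lam \<and> young lam = S"
proof -
  \<comment> \<open>The number of parts is the length of the first column, read off as row 1 of the
    transposed diagram.\<close>
  define N where "N = row_len (prod.swap ` S) 1"
  have N: "1 \<le> row_len S i \<longleftrightarrow> i \<le> N" if "1 \<le> i" for i
  proof -
    have "(i, 1) \<in> S \<longleftrightarrow> (1, i) \<in> prod.swap ` S" by force
    then show ?thesis
      using that mem_diagram_iff[OF assms, of i 1] mem_diagram_iff[OF diagram_swap[OF assms], of 1 i]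
      by (auto simp: N_def)
  qed
  define lam where "lam = map (\<lambda>k. row_len S (Suc k)) [0..<N]"
  have "is_partition lam"
    unfolding is_partition_def
  proof
    show "sorted_wrt (\<ge>) lam"
      using row_len_antimono[OF assms] by (auto simp: sorted_wrt_iff_nth_less lam_def)
    have "row_len S (Suc k) \<noteq> 0" if "k < N" for k using N[of "Suc k"] that by auto
    then show "0 \<notin> set lam" by (force simp: lam_def)
  qed
  moreover have "young lam = S"
  proof (intro set_eqI)
    fix c :: cell
    obtain i j where ij: "c = (i, j)" by (cases c)
    show "c \<in> young lam \<longleftrightarrow> c \<in> S"
    proof (cases "1 \<le> i \<and> i \<le> N")
      case True
      then show ?thesis using ij by (auto simp: mem_young lam_def mem_diagram_iff[OF assms])
    next
      case False
      then show ?thesis using ij N[of i] by (auto simp: mem_young lam_def mem_diagram_iff[OF assms])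
    qed
  qed
  ultimately show ?thesis by blast
qed

lemma bij_betw_young: "bij_betw young {lam. is_partition lam} {S. diagram S}"
proof (rule bij_betw_imageI)
  show "inj_on young {lam. is_partition lam}" by (auto simp: inj_on_def young_inj)
  show "young ` {lam. is_partition lam} = {S. diagram S}" using young_surj diagram_young by auto
qed

subsection \<open>Recursions for the sign imbalance\<close>

text \<open>If \<open>c\<close> carries an entry larger than all entries in \<open>S\<close>, the
  cells counted here are exactly those with which it forms an inversion.\<close>

definition pos_sign :: "cell set \<Rightarrow> cell \<Rightarrow> int" where
  "pos_sign S c = (- 1) ^ card {b \<in> S. c \<lhd> b}"

lemma cell_less_irrefl: "\<not> c \<lhd> c"
  by (simp add: cell_less_def)

lemma cell_less_total: "c \<noteq> d \<Longrightarrow> c \<lhd> d \<longleftrightarrow> \<not> d \<lhd> c"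
  by (auto simp: cell_less_def prod_eq_iff)

lemma pos_sign_insert:
  assumes "finite S" "a \<notin> S"
  shows "pos_sign (insert a S) c = (if c \<lhd> a then - pos_sign S c else pos_sign S c)"
proof (cases "c \<lhd> a")
  case True
  then have "{b \<in> insert a S. c \<lhd> b} = insert a {b \<in> S. c \<lhd> b}" by auto
  then show ?thesis using True assms by (simp add: pos_sign_def)
next
  case False
  then have "{b \<in> insert a S. c \<lhd> b} = {b \<in> S. c \<lhd> b}" by auto
  then show ?thesis using False by (simp add: pos_sign_def)
qed

text \<open>Exactly one of \<open>c\<close> and \<open>d\<close> precedes the other, so exactly one
  of the two signs flips. This is the source of the anticommutation.\<close>

lemma pos_sign_exchange:
  assumes "finite S" "c \<notin> S" "d \<notin> S" "c \<noteq> d"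
  shows "pos_sign (insert d S) c * pos_sign (insert c S) d = - (pos_sign S c * pos_sign S d)"
  using assms cell_less_total[of c d] by (auto simp: pos_sign_insert)

lemma pos_sign_square: "pos_sign S c * pos_sign S c = 1"
  by (simp add: pos_sign_def flip: power_mult_distrib)

text \<open>This is the set from \<open>straight_sign_diamond\<close>, for arbitrary sets of cells.
  In the second part \<open>b\<close> carries an entry of the inner tableau, which is smaller than
  every outer entry; the inner tableau itself has dropped out.\<close>

definition inversions :: "cell set \<Rightarrow> cell set \<Rightarrow> (cell \<Rightarrow> nat) \<Rightarrow> (cell \<times> cell) set" where
  "inversions L M T = {(a, b). a \<in> L - M \<and> b \<in> L - M \<and> a \<lhd> b \<and> T a > T b} \<union>
      {(a, b). a \<in> L - M \<and> b \<in> M \<and> a \<lhd> b}"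

definition imb :: "cell set \<Rightarrow> cell set \<Rightarrow> int" where
  "imb L M = (\<Sum>T\<in>SYT (L - M). (- 1) ^ card (inversions L M T))"

definition maximal_cells :: "cell set \<Rightarrow> cell set" where
  "maximal_cells D = {c \<in> D. \<forall>d\<in>D. fst c \<le> fst d \<longrightarrow> snd c \<le> snd d \<longrightarrow> d = c}"

lemma SYT_D:
  assumes "T \<in> SYT D"
  shows "T \<in> extensional D" "bij_betw T D {1..card D}"
    "\<And>c d. c \<in> D \<Longrightarrow> d \<in> D \<Longrightarrow> fst c \<le> fst d \<Longrightarrow> snd c \<le> snd d \<Longrightarrow> T c \<le> T d"
  using assms unfolding SYT_def by auto

lemma SYT_I:
  assumes "T \<in> extensional D" "bij_betw T D {1..card D}"
    "\<And>c d. c \<in> D \<Longrightarrow> d \<in> D \<Longrightarrow> fst c \<le> fst d \<Longrightarrow> snd c \<le> snd d \<Longrightarrow> T c \<le> T d"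
  shows "T \<in> SYT D"
  using assms(1,2) assms(3)[of "(_, _)" "(_, _)"] unfolding SYT_def by simp

lemma SYT_range: "T \<in> SYT D \<Longrightarrow> c \<in> D \<Longrightarrow> T c \<in> {1..card D}"
  by (rule bij_betw_apply[OF SYT_D(2)])

lemma finite_SYT: "finite D \<Longrightarrow> finite (SYT D)"
proof (rule finite_subset)
  show "SYT D \<subseteq> PiE D (\<lambda>_. {1..card D})"
    using SYT_range SYT_D(1) by (auto simp: PiE_def)
qed (auto intro: finite_PiE)

lemma SYT_max_cell:
  assumes "T \<in> SYT D" "c \<in> D" "T c = card D"
  shows "c \<in> maximal_cells D"
proof -
  have "d = c" if d: "d \<in> D" "fst c \<le> fst d" "snd c \<le> snd d" for d
  proof -
    have "T d = T c"
      using SYT_D(3)[OF assms(1,2) d] SYT_range[OF assms(1) d(1)] assms(3) by simp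
    then show ?thesis
      using bij_betw_imp_inj_on[OF SYT_D(2)[OF assms(1)]] assms(2) d(1) by (auto dest: inj_onD)
  qed
  then show ?thesis using assms(2) by (auto simp: maximal_cells_def)
qed

lemma SYT_remove_max:
  assumes T: "T \<in> SYT D" and c: "c \<in> D" "T c = card D" and D: "finite D"
  shows "restrict T (D - {c}) \<in> SYT (D - {c})"
proof (rule SYT_I)
  have "bij_betw T (D - {c}) ({1..card D} - {card D})"
    using bij_betw_DiffI[OF SYT_D(2)[OF T], of "{c}" "{card D}"] c SYT_range[OF T c(1)] by auto
  moreover have "{1..card D} - {card D} = {1..card (D - {c})}"
    using c D by (auto simp: card_Diff_singleton)
  ultimately show "bij_betw (restrict T (D - {c})) (D - {c}) {1..card (D - {c})}"
    by (subst bij_betw_cong[of _ _ T]) auto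
  show "restrict T (D - {c}) a \<le> restrict T (D - {c}) b"
    if "a \<in> D - {c}" "b \<in> D - {c}" "fst a \<le> fst b" "snd a \<le> snd b" for a b
    using that SYT_D(3)[OF T, of a b] by simp
qed simp

lemma SYT_extend_max:
  assumes T: "T \<in> SYT (D - {c})" and c: "c \<in> maximal_cells D" and D: "finite D"
  shows "T(c := card D) \<in> SYT D"
proof (rule SYT_I)
  have cD: "c \<in> D" using c by (simp add: maximal_cells_def)
  then have card: "card D = Suc (card (D - {c}))" using D by (metis card.remove)
  show "T(c := card D) \<in> extensional D"
    using SYT_D(1)[OF T] cD by (auto simp: extensional_def)
  have "bij_betw (T(c := card D)) (D - {c}) {1..card (D - {c})}"
    using SYT_D(2)[OF T] by (subst bij_betw_cong[of _ _ T]) auto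
  then have "bij_betw (T(c := card D)) (insert c (D - {c})) (insert ((T(c := card D)) c) {1..card (D - {c})})"
    by (rule notIn_Un_bij_betw[of c, simplified, rotated 2]) (auto simp: card)
  moreover have "insert c (D - {c}) = D" using cD by blast
  moreover have "insert ((T(c := card D)) c) {1..card (D - {c})} = {1..card D}" using card by auto
  ultimately show "bij_betw (T(c := card D)) D {1..card D}" by simp
  show "(T(c := card D)) a \<le> (T(c := card D)) b"
    if "a \<in> D" "b \<in> D" "fst a \<le> fst b" "snd a \<le> snd b" for a b
  proof (cases "a = c")
    case True
    then show ?thesis using that c by (auto simp: maximal_cells_def)
  next
    case False
    then show ?thesis
      using that SYT_D(3)[OF T, of a b] SYT_range[OF T, of a] card by auto
  qed
qed

text \<open>Tableaux are sorted by the cell of their largest entry; deleting that entry and putting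
  it back are inverse operations.\<close>

lemma sum_SYT:
  fixes g :: "(cell \<Rightarrow> nat) \<Rightarrow> 'b::comm_monoid_add"
  assumes D: "finite D" "D \<noteq> {}"
  shows "(\<Sum>T\<in>SYT D. g T) = (\<Sum>c\<in>maximal_cells D. \<Sum>T\<in>SYT (D - {c}). g (T(c := card D)))"
proof -
  define top where "top T = the_inv_into D T (card D)" for T :: "cell \<Rightarrow> nat"
  have top: "top T \<in> D" "T (top T) = card D" if T: "T \<in> SYT D" for T
  proof -
    have "card D \<in> {1..card D}" using D by (simp add: card_gt_0_iff Suc_le_eq)
    then have n: "card D \<in> T ` D" using bij_betw_imp_surj_on[OF SYT_D(2)[OF T]] by simp
    have inj: "inj_on T D" using bij_betw_imp_inj_on[OF SYT_D(2)[OF T]] .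
    show "top T \<in> D" unfolding top_def by (rule the_inv_into_into[OF inj n order_refl])
    show "T (top T) = card D" unfolding top_def by (rule f_the_inv_into_f[OF inj n])
  qed
  have top_eq: "top T = c" if "T \<in> SYT D" "c \<in> D" "T c = card D" for T c
    using inj_onD[OF bij_betw_imp_inj_on[OF SYT_D(2)[OF that(1)]], of "top T" c] top[OF that(1)] that by simp
  have fin: "finite (maximal_cells D)" using D by (simp add: maximal_cells_def)
  have "(\<Sum>T\<in>SYT D. g T) =
      (\<Sum>(c, T)\<in>(SIGMA c:maximal_cells D. SYT (D - {c})). g (T(c := card D)))"
  proof (rule sum.reindex_bij_witness[where
        i = "\<lambda>(c, T). T(c := card D)" and j = "\<lambda>T. (top T, restrict T (D - {top T}))"])
    fix T assume T: "T \<in> SYT D"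
    note tp = top[OF T]
    have "(restrict T (D - {top T}))(top T := card D) = T"
      using SYT_D(1)[OF T] tp by (auto simp: fun_eq_iff extensional_def)
    then show "(case (top T, restrict T (D - {top T})) of (c, T) \<Rightarrow> T(c := card D)) = T"
      "(case (top T, restrict T (D - {top T})) of (c, T) \<Rightarrow> g (T(c := card D))) = g T"
      by simp_all
    show "(top T, restrict T (D - {top T})) \<in> (SIGMA c:maximal_cells D. SYT (D - {c}))"
      using SYT_max_cell[OF T tp] SYT_remove_max[OF T tp D(1)] by simp
  next
    fix p assume p: "p \<in> (SIGMA c:maximal_cells D. SYT (D - {c}))"
    then obtain c T where cT: "p = (c, T)" "c \<in> maximal_cells D" "T \<in> SYT (D - {c})" by auto
    have S: "T(c := card D) \<in> SYT D" using SYT_extend_max[OF cT(3,2) D(1)] .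
    then show "(case p of (c, T) \<Rightarrow> T(c := card D)) \<in> SYT D" by (simp add: cT)
    have "top (T(c := card D)) = c" using cT(2) by (intro top_eq[OF S]) (auto simp: maximal_cells_def)
    \<comment> \<open>Restriction resets the value at \<open>c\<close> to \<open>undefined\<close>,
      which is what the extensional \<open>T\<close> has there.\<close>
    moreover have "restrict (T(c := card D)) (D - {c}) = T"
      using SYT_D(1)[OF cT(3)] by (auto simp: fun_eq_iff extensional_def)
    ultimately show "(top (case p of (c, T) \<Rightarrow> T(c := card D)), restrict (case p of (c, T) \<Rightarrow> T(c := card D))
        (D - {top (case p of (c, T) \<Rightarrow> T(c := card D))})) = p"
      by (simp add: cT)
  qed
  also have "\<dots> = (\<Sum>c\<in>maximal_cells D. \<Sum>T\<in>SYT (D - {c}). g (T(c := card D)))"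
    using fin finite_SYT[of "D - {_}"] D(1) by (subst sum.Sigma) auto
  finally show ?thesis .
qed

text \<open>Everything to the lower right of a cell outside \<open>M\<close> is outside
  \<open>M\<close> too, since \<open>M\<close> is down-closed. So maximality in \<open>L - M\<close>
  is the same as being a corner of \<open>L\<close>.\<close>

lemma maximal_cells_skew:
  assumes L: "diagram L" and M: "diagram M"
  shows "maximal_cells (L - M) = removable L - M"
proof (intro set_eqI iffI)
  fix c assume c: "c \<in> maximal_cells (L - M)"
  then have cL: "c \<in> L" "c \<notin> M" by (auto simp: maximal_cells_def)
  have "diagram (L - {c})"
    unfolding diagram_def
  proof (intro conjI allI impI)
    show "finite (L - {c})" "L - {c} \<subseteq> {1..} \<times> {1..}" using L by (auto simp: diagram_def)
    fix i j i' j' assume a: "(i', j') \<in> L - {c}" "1 \<le> i" "i \<le> i'" "1 \<le> j" "j \<le> j'"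
    have "(i, j) \<noteq> c"
    proof
      assume e: "(i, j) = c"
      then have "(i', j') \<notin> M" using diagramD[OF M, of i' j' i j] a cL by blast
      then have "(i', j') \<in> L - M" using a by blast
      moreover have "fst c \<le> fst (i', j')" "snd c \<le> snd (i', j')" using a e by auto
      ultimately have "(i', j') = c" using c unfolding maximal_cells_def by blast
      then show False using a by blast
    qed
    then show "(i, j) \<in> L - {c}" using diagramD[OF L, of i' j' i j] a by blast
  qed
  then show "c \<in> removable L - M" using cL unfolding removable_def by blast
next
  fix c assume c: "c \<in> removable L - M"
  obtain i j where ij: "c = (i, j)" by (cases c)
  have "d = c" if "d \<in> L - M" "fst c \<le> fst d" "snd c \<le> snd d" for d
  proof (rule ccontr)
    assume "d \<noteq> c"
    then have "(fst d, snd d) \<in> L - {c}" using that by simp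
    moreover have "1 \<le> i" "1 \<le> j" using diagram_pos[OF L, of i j] c ij by (auto simp: removable_def)
    ultimately have "c \<in> L - {c}"
      using diagramD[of "L - {c}" "fst d" "snd d" i j] c that ij by (auto simp: removable_def)
    then show False by blast
  qed
  then show "c \<in> maximal_cells (L - M)" using c by (auto simp: removable_def maximal_cells_def)
qed

text \<open>The largest entry, at \<open>c\<close>, is inverted with every cell after
  \<open>c\<close>: with those outside \<open>M\<close> by size, with those in \<open>M\<close> by
  the second part of \<open>inversions\<close>. Cells before \<open>c\<close> form no inversion with
  it.\<close>

lemma inversions_extend_max:
  assumes c: "c \<in> L" "c \<notin> M" and sub: "M \<subseteq> L" and fin: "finite L"
    and T: "T \<in> SYT (L - M - {c})"
  shows "(- 1 :: int) ^ card (inversions L M (T(c := card (L - M)))) =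
    pos_sign (L - {c}) c * (- 1) ^ card (inversions (L - {c}) M T)"
proof -
  have Tlt: "T b < card (L - M)" if "b \<in> L - M" "b \<noteq> c" for b
  proof -
    have "card (L - M) = Suc (card (L - M - {c}))" using fin c by (metis DiffI card.remove finite_Diff)
    then show ?thesis using SYT_range[OF T, of b] that by simp
  qed
  have "inversions L M (T(c := card (L - M))) =
      inversions (L - {c}) M T \<union> Pair c ` {b \<in> L - {c}. c \<lhd> b}"
  proof (intro set_eqI)
    fix p :: "cell \<times> cell"
    obtain a b where p: "p = (a, b)" by (cases p)
    show "p \<in> inversions L M (T(c := card (L - M))) \<longleftrightarrow>
        p \<in> inversions (L - {c}) M T \<union> Pair c ` {b \<in> L - {c}. c \<lhd> b}"
    proof (cases "a = c")
      case True
      then show ?thesis using c sub Tlt[of b] cell_less_irrefl[of c] unfolding p inversions_def by auto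
    next
      case False
      then show ?thesis using c Tlt[of a] unfolding p inversions_def by auto
    qed
  qed
  moreover have "inversions (L - {c}) M T \<inter> Pair c ` {b \<in> L - {c}. c \<lhd> b} = {}"
    unfolding inversions_def by blast
  moreover have "inversions (L - {c}) M T \<subseteq> L \<times> L"
    using sub unfolding inversions_def by blast
  then have "finite (inversions (L - {c}) M T)" using fin finite_subset by blast
  ultimately have "card (inversions L M (T(c := card (L - M)))) =
      card (inversions (L - {c}) M T) + card {b \<in> L - {c}. c \<lhd> b}"
    using fin by (simp add: card_Un_disjoint card_image inj_on_def)
  then show ?thesis by (simp add: pos_sign_def power_add)
qed

lemma imb_self: "imb L L = 1"
proof -
  \<comment> \<open>The empty shape has exactly one tableau, because an extensional function on it
    is \<open>undefined\<close> everywhere.\<close>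
  have "SYT {} = {\<lambda>_. undefined}" by (auto simp: SYT_def bij_betw_def)
  then show ?thesis by (simp add: imb_def inversions_def)
qed

lemma imb_remove_max:
  assumes L: "diagram L" and M: "diagram M" and sub: "M \<subset> L"
  shows "imb L M = (\<Sum>c\<in>removable L - M. pos_sign (L - {c}) c * imb (L - {c}) M)"
proof -
  have fin: "finite L" using L by (rule diagram_finite)
  have "imb L M = (\<Sum>c\<in>removable L - M. \<Sum>T\<in>SYT (L - M - {c}).
      (- 1) ^ card (inversions L M (T(c := card (L - M)))))"
    unfolding imb_def maximal_cells_skew[OF L M, symmetric] using fin sub by (intro sum_SYT) auto
  also have "\<dots> = (\<Sum>c\<in>removable L - M. \<Sum>T\<in>SYT (L - M - {c}).
      pos_sign (L - {c}) c * (- 1) ^ card (inversions (L - {c}) M T))"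
    using sub fin by (intro sum.cong refl inversions_extend_max) (auto simp: removable_def)
  also have "\<dots> = (\<Sum>c\<in>removable L - M. pos_sign (L - {c}) c * imb (L - {c}) M)"
    unfolding imb_def sum_distrib_left
    by (intro sum.cong arg_cong2[where f = sum] arg_cong[where f = SYT] refl) blast
  finally show ?thesis .
qed

text \<open>Moving the cell \<open>d\<close> of the smallest entry into the inner shape keeps every
  inversion \<open>(a, d)\<close> and loses only the pairs \<open>(d, b)\<close> with
  \<open>b\<close> in \<open>M\<close>, whence \<open>pos_sign M d\<close>. To avoid shifting
  entries, the proof peels off largest entries, by induction on \<open>card L\<close>.\<close>

lemma imb_remove_min:
  assumes "diagram L" and M: "diagram M" and "M \<subset> L"
  shows "imb L M = (\<Sum>d\<in>addable M \<inter> L. pos_sign M d * imb L (insert d M))"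
  using assms(1,3)
proof (induction "card L" arbitrary: L rule: less_induct)
  case less
  note L = less.prems(1)
  have fin: "finite L" using L by (rule diagram_finite)
  note maxrec = imb_remove_max[OF L M less.prems(2)]
  \<comment> \<open>A single outer cell holds both the smallest and the largest entry, and the two
    recursions coincide. Otherwise outer cells remain after either deletion.\<close>
  show ?case
  proof (cases "\<exists>c. L = insert c M")
    case True
    then obtain c where c: "L = insert c M" "c \<notin> M" using less.prems(2) by blast
    then have "removable L - M = {c}" "addable M \<inter> L = {c}" "L - {c} = M"
      using L M by (auto simp: removable_def addable_def)
    then show ?thesis using maxrec c by (simp add: imb_self)
  next
    case False
    have step1: "imb (L - {c}) M = (\<Sum>d\<in>addable M \<inter> (L - {c}). pos_sign M d * imb (L - {c}) (insert d M))"
      if c: "c \<in> removable L - M" for c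
    proof (rule less.hyps)
      show "card (L - {c}) < card L" using c fin card_Diff1_less[of L c] by (simp add: removable_def)
      show "diagram (L - {c})" using c by (simp add: removable_def)
      show "M \<subset> L - {c}" using c False less.prems(2) by (auto simp: removable_def)
    qed
    have step2: "imb L (insert d M) =
        (\<Sum>c\<in>removable L - insert d M. pos_sign (L - {c}) c * imb (L - {c}) (insert d M))"
      if d: "d \<in> addable M \<inter> L" for d
    proof (rule imb_remove_max[OF L])
      show "diagram (insert d M)" using d by (simp add: addable_def)
      show "insert d M \<subset> L" using d False less.prems(2) by blast
    qed
    have finR: "finite (removable L - M)" and finA: "finite (addable M \<inter> L)"
      using finite_removable[OF L] fin by auto
    \<comment> \<open>The largest and the smallest entry now sit in different cells \<open>c\<close>
      and \<open>d\<close>, and the double sum over both can be read in either order.\<close>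
    have "imb L M = (\<Sum>c\<in>removable L - M. \<Sum>d | d \<in> addable M \<inter> L \<and> d \<noteq> c.
        pos_sign (L - {c}) c * (pos_sign M d * imb (L - {c}) (insert d M)))"
      unfolding maxrec by (intro sum.cong refl) (auto simp: step1 sum_distrib_left intro!: sum.cong)
    also have "\<dots> = (\<Sum>d\<in>addable M \<inter> L. \<Sum>c | c \<in> removable L - M \<and> d \<noteq> c.
        pos_sign (L - {c}) c * (pos_sign M d * imb (L - {c}) (insert d M)))"
      by (rule sum.swap_restrict[OF finR finA])
    also have "\<dots> = (\<Sum>d\<in>addable M \<inter> L. pos_sign M d * imb L (insert d M))"
      by (intro sum.cong refl) (auto simp: step2 sum_distrib_left intro!: sum.cong)
    finally show ?thesis .
  qed
qed

text \<open>This guarantees that the \<open>SOME\<close> in \<open>skew_sign\<close> picks a genuine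
  tableau of the inner shape.\<close>

lemma SYT_diagram_nonempty:
  assumes "diagram S" shows "SYT S \<noteq> {}"
  using assms
proof (induction "card S" arbitrary: S rule: less_induct)
  case less
  show ?case
  proof (cases "S = {}")
    case True
    then show ?thesis by (auto simp: SYT_def bij_betw_def)
  next
    case False
    then obtain c where c: "c \<in> removable S" using removable_nonempty[OF less.prems] by blast
    then have "c \<in> S" by (simp add: removable_def)
    then have "card (S - {c}) < card S"
      using diagram_finite[OF less.prems] by (metis card_Diff1_less)
    then obtain T where T: "T \<in> SYT (S - {c})" using less.hyps[of "S - {c}"] c by (auto simp: removable_def)
    have "c \<in> maximal_cells S"
      using c maximal_cells_skew[OF less.prems diagram_empty] by simp
    from SYT_extend_max[OF T this diagram_finite[OF less.prems]] show ?thesis by blast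
  qed
qed

lemma sign_imbalance_eq_imb:
  assumes mu: "is_partition mu" and sub: "young mu \<subseteq> young lam"
  shows "sign_imbalance lam mu = imb (young lam) (young mu)"
proof -
  obtain T0 where T0: "T0 \<in> SYT (young mu)"
    using SYT_diagram_nonempty[OF diagram_young[OF mu]] by blast
  show ?thesis
    unfolding sign_imbalance_def imb_def inversions_def skew_def
    using skew_sign_independent[OF sub T0] straight_sign_diamond[OF sub T0]
    by (intro sum.cong refl) (simp add: skew_def)
qed

subsection \<open>The signed up and down operators\<close>

text \<open>The operators act on functions of diagrams, so the value at \<open>S\<close> collects
  values at enlarged diagrams. Iterates applied to the constant 1 sum signed weights over growth
  chains starting at \<open>S\<close>.\<close>

definition up_op :: "(cell \<Rightarrow> 'a::field_char_0) \<Rightarrow> (cell set \<Rightarrow> 'a) \<Rightarrow> cell set \<Rightarrow> 'a" where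
  "up_op w f S = (\<Sum>c\<in>addable S. of_int (pos_sign S c) * w c * f (insert c S))"

definition down_op :: "(cell \<Rightarrow> 'a::field_char_0) \<Rightarrow> (cell set \<Rightarrow> 'a) \<Rightarrow> cell set \<Rightarrow> 'a" where
  "down_op w f S = (\<Sum>c\<in>removable S. of_int (pos_sign (S - {c}) c) * w c * f (S - {c}))"

lemma up_op_cong: "(\<And>T. diagram T \<Longrightarrow> f T = g T) \<Longrightarrow> up_op w f S = up_op w g S"
  unfolding up_op_def by (intro sum.cong) (auto simp: addable_def)

lemma down_op_cong: "(\<And>T. diagram T \<Longrightarrow> f T = g T) \<Longrightarrow> down_op w f S = down_op w g S"
  unfolding down_op_def by (intro sum.cong) (auto simp: removable_def)

lemma up_op_diff: "up_op w (\<lambda>T. f T - g T) S = up_op w f S - up_op w g S"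
  by (simp add: up_op_def right_diff_distrib sum_subtractf)

lemma up_op_add: "up_op w (\<lambda>T. f T + g T) S = up_op w f S + up_op w g S"
  by (simp add: up_op_def distrib_left sum.distrib)

lemma down_op_add: "down_op w (\<lambda>T. f T + g T) S = down_op w f S + down_op w g S"
  by (simp add: down_op_def distrib_left sum.distrib)

lemma up_op_scale: "up_op w (\<lambda>T. k * f T) S = k * up_op w f S"
  by (simp add: up_op_def sum_distrib_left mult_ac)

lemma down_op_scale: "down_op w (\<lambda>T. k * f T) S = k * down_op w f S"
  by (simp add: down_op_def sum_distrib_left mult_ac)

text \<open>Diagrams are closed under union and intersection: the union with \<open>S\<close>
  restores \<open>d\<close>, the intersection with \<open>S\<close> drops \<open>c\<close>.\<close>

lemma diagram_of_exchange:
  assumes S: "diagram S" and c: "c \<notin> S" and d: "d \<in> S"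
    and ex: "diagram (insert c S - {d})"
  shows "diagram (insert c S)" and "diagram (S - {d})"
proof -
  have "S \<union> (insert c S - {d}) = insert c S" using d by blast
  then show "diagram (insert c S)" using diagram_Un[OF S ex] by simp
  have "S \<inter> (insert c S - {d}) = S - {d}" using c by blast
  then show "diagram (S - {d})" using diagram_Int[OF S ex] by simp
qed

text \<open>Pairs of different cells occur in both products with opposite signs. The pairs with
  \<open>c = d\<close> give \<open>f S\<close> times a sum of row signs, in which each removable
  corner cancels the addable one in the row below, and only row 1 is left.\<close>

lemma up_down_anticommute:
  assumes S: "diagram S" and ww: "\<And>c. w c * w' c = (- 1) ^ Suc (fst c)"
  shows "up_op w (down_op w' f) S + down_op w' (up_op w f) S = f S"
proof -
  \<comment> \<open>\<open>Q c d\<close> says that the exchange yields a diagram. It fails, for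
    example, when \<open>c\<close> is the right neighbour of \<open>d\<close>.\<close>
  define Q where "Q c d \<longleftrightarrow> diagram (insert c S - {d})" for c d
  define g where "g c d = of_int (pos_sign S c) * w c *
      (of_int (pos_sign (insert c S - {d}) d) * w' d * f (insert c S - {d}))" for c d
  define h where "h d c = of_int (pos_sign (S - {d}) d) * w' d *
      (of_int (pos_sign (S - {d}) c) * w c * f (insert c (S - {d})))" for c d
  have fin: "finite S" "finite (addable S)" "finite (removable S)"
    using diagram_finite[OF S] finite_addable[OF S] finite_removable[OF S] by auto
  have ad: "c \<notin> S" "diagram (insert c S)" if "c \<in> addable S" for c
    using that by (auto simp: addable_def)
  have rd: "d \<in> S" "diagram (S - {d})" if "d \<in> removable S" for d
    using that by (auto simp: removable_def)
  have R: "removable (insert c S) = insert c {d \<in> removable S. Q c d}" if c: "c \<in> addable S" for c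
  proof (intro set_eqI iffI)
    fix d assume d: "d \<in> removable (insert c S)"
    show "d \<in> insert c {d \<in> removable S. Q c d}"
    proof (cases "d = c")
      case False
      then have "d \<in> S" "Q c d" using d by (auto simp: removable_def Q_def)
      moreover from this have "diagram (S - {d})"
        using diagram_of_exchange(2)[OF S ad(1)[OF c]] by (simp add: Q_def)
      ultimately show ?thesis by (simp add: removable_def)
    qed simp
  next
    fix d assume "d \<in> insert c {d \<in> removable S. Q c d}"
    then show "d \<in> removable (insert c S)" using S ad[OF c] by (auto simp: removable_def Q_def)
  qed
  have A: "addable (S - {d}) = insert d {c \<in> addable S. Q c d}" if d: "d \<in> removable S" for d
  proof (intro set_eqI iffI)
    fix c assume c: "c \<in> addable (S - {d})"
    show "c \<in> insert d {c \<in> addable S. Q c d}"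
    proof (cases "c = d")
      case False
      then have c': "c \<notin> S" "diagram (insert c (S - {d}))" using c by (auto simp: addable_def)
      moreover have "insert c S - {d} = insert c (S - {d})" using False by blast
      ultimately have "Q c d" by (simp add: Q_def)
      then show ?thesis
        using diagram_of_exchange(1)[OF S c'(1) rd(1)[OF d]] c' by (simp add: addable_def Q_def)
    qed simp
  next
    fix c assume c: "c \<in> insert d {c \<in> addable S. Q c d}"
    show "c \<in> addable (S - {d})"
    proof (cases "c = d")
      case True
      then show ?thesis using S rd(1)[OF d] by (simp add: addable_def insert_absorb)
    next
      case False
      then have "insert c S - {d} = insert c (S - {d})" by blast
      then show ?thesis using c False by (auto simp: addable_def Q_def)
    qed
  qed
  have gc: "g c c = (- 1) ^ Suc (fst c) * f S" if "c \<in> addable S" for c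
  proof -
    have "insert c S - {c} = S" using ad(1)[OF that] by blast
    then have "g c c = of_int (pos_sign S c * pos_sign S c) * (w c * w' c) * f S"
      by (simp add: g_def mult_ac)
    then show ?thesis by (simp add: pos_sign_square ww)
  qed
  have hd: "h d d = (- 1) ^ Suc (fst d) * f S" if "d \<in> removable S" for d
  proof -
    have "insert d (S - {d}) = S" using rd(1)[OF that] by blast
    then have "h d d = of_int (pos_sign (S - {d}) d * pos_sign (S - {d}) d) * (w d * w' d) * f S"
      by (simp add: h_def mult_ac)
    then show ?thesis by (simp add: pos_sign_square ww)
  qed
  have anti: "h d c = - g c d" if "c \<in> addable S" "d \<in> removable S" for c d
  proof -
    define P where "P = S - {d}"
    have P: "S = insert d P" "c \<notin> P" "d \<notin> P" "c \<noteq> d" "finite P" "insert c S - {d} = insert c P"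
      using ad(1)[OF that(1)] rd(1)[OF that(2)] fin by (auto simp: P_def)
    have "g c d = of_int (pos_sign (insert d P) c * pos_sign (insert c P) d) * (w c * w' d * f (insert c P))"
      unfolding g_def P(6) using P(1) by (simp add: mult_ac)
    also have "\<dots> = - h d c"
      unfolding pos_sign_exchange[OF P(5,2,3,4)] h_def P_def[symmetric] by (simp add: mult_ac)
    finally show ?thesis by simp
  qed
  have "up_op w (down_op w' f) S = (\<Sum>c\<in>addable S. \<Sum>d\<in>removable (insert c S). g c d)"
    by (simp add: up_op_def down_op_def g_def sum_distrib_left)
  also have "\<dots> = (\<Sum>c\<in>addable S. g c c + (\<Sum>d | d \<in> removable S \<and> Q c d. g c d))"
    by (intro sum.cong refl, subst R, assumption, subst sum.insert) (use fin ad in \<open>auto simp: removable_def\<close>)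
  finally have 1: "up_op w (down_op w' f) S =
      (\<Sum>c\<in>addable S. (- 1) ^ Suc (fst c) * f S) + (\<Sum>c\<in>addable S. \<Sum>d | d \<in> removable S \<and> Q c d. g c d)"
    unfolding sum.distrib by (simp only: gc cong: sum.cong)
  have "down_op w' (up_op w f) S = (\<Sum>d\<in>removable S. \<Sum>c\<in>addable (S - {d}). h d c)"
    by (simp add: up_op_def down_op_def h_def sum_distrib_left)
  also have "\<dots> = (\<Sum>d\<in>removable S. h d d + (\<Sum>c | c \<in> addable S \<and> Q c d. h d c))"
    by (intro sum.cong refl, subst A, assumption, subst sum.insert) (use fin rd(1) ad(1) in \<open>auto dest: rd(1) ad(1)\<close>)
  finally have 2: "down_op w' (up_op w f) S =
      (\<Sum>d\<in>removable S. (- 1) ^ Suc (fst d) * f S) + (\<Sum>d\<in>removable S. \<Sum>c | c \<in> addable S \<and> Q c d. h d c)"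
    unfolding sum.distrib by (simp only: hd cong: sum.cong)
  have "(\<Sum>d\<in>removable S. \<Sum>c | c \<in> addable S \<and> Q c d. h d c) =
      (\<Sum>d\<in>removable S. \<Sum>c | c \<in> addable S \<and> Q c d. - g c d)"
    using anti by (intro sum.cong refl) auto
  also have "\<dots> = - (\<Sum>c\<in>addable S. \<Sum>d | d \<in> removable S \<and> Q c d. g c d)"
    by (subst sum.swap_restrict[OF fin(3,2)]) (simp add: sum_negf)
  finally have 3: "(\<Sum>d\<in>removable S. \<Sum>c | c \<in> addable S \<and> Q c d. h d c) =
      - (\<Sum>c\<in>addable S. \<Sum>d | d \<in> removable S \<and> Q c d. g c d)" .
  \<comment> \<open>An addable corner in row \<open>i + 1\<close> goes with a removable one in row
    \<open>i\<close>, whose sign is opposite; row 1 contributes \<open>f S\<close> itself.\<close>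
  have "(\<Sum>c\<in>addable S. (- 1) ^ Suc (fst c) * f S) =
      f S + (\<Sum>c\<in>removable S. (- 1) ^ Suc (Suc (fst c)) * f S)"
    using sum_strips_add[OF S order_refl, of "\<lambda>i. (- 1) ^ Suc i * f S"]
    by (simp add: addable_eq_strips removable_eq_strips)
  then show ?thesis unfolding 1 2 3 by (simp add: sum_negf)
qed

text \<open>Two uses of \<open>UD = 1 - DU\<close> give
  \<open>U(UD) = U - (UD)U = U - (1 - DU)U = DUU\<close>.\<close>

lemma up_up_down_commute:
  assumes S: "diagram S" and ww: "\<And>c. w c * w' c = (- 1) ^ Suc (fst c)"
  shows "up_op w (up_op w (down_op w' f)) S = down_op w' (up_op w (up_op w f)) S"
proof -
  have ud: "up_op w (down_op w' g) T = g T - down_op w' (up_op w g) T" if "diagram T" for g T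
    using up_down_anticommute[where f = g and w = w and w' = w', OF that ww] by (simp add: algebra_simps)
  have "up_op w (up_op w (down_op w' f)) S = up_op w (\<lambda>T. f T - down_op w' (up_op w f) T) S"
    by (rule up_op_cong) (rule ud)
  also have "\<dots> = up_op w f S - up_op w (down_op w' (up_op w f)) S" by (rule up_op_diff)
  also have "\<dots> = down_op w' (up_op w (up_op w f)) S" by (simp add: ud[OF S])
  finally show ?thesis .
qed

section \<open>Dominoes and two successive steps\<close>

definition right :: "cell \<Rightarrow> cell" where "right c = (fst c, Suc (snd c))"

definition below :: "cell \<Rightarrow> cell" where "below c = (Suc (fst c), snd c)"

text \<open>Vertical dominoes are the horizontal ones of the transposed diagram; they are indexed by
  their upper cell.\<close>

definition vstrips_add :: "cell set \<Rightarrow> cell set" where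
  "vstrips_add S = prod.swap ` strips_add 2 (prod.swap ` S)"

definition vstrips_rem :: "cell set \<Rightarrow> cell set" where
  "vstrips_rem S = prod.swap ` strips_rem 2 (prod.swap ` S)"

lemma row_strip_2: "row_strip 2 c = {c, right c}"
  by (cases c) (auto simp: row_strip_def right_def)

lemma mem_strips_add_2: "c \<in> strips_add 2 S \<longleftrightarrow> c \<notin> S \<and> right c \<notin> S \<and> diagram (insert (right c) (insert c S))"
proof -
  have "S \<union> {c, right c} = insert (right c) (insert c S)" by blast
  then show ?thesis by (simp add: strips_add_def row_strip_2)
qed

lemma mem_strips_rem_2: "c \<in> strips_rem 2 S \<longleftrightarrow> c \<in> S \<and> right c \<in> S \<and> diagram (S - {right c} - {c})"
proof -
  have "S - {c, right c} = S - {right c} - {c}" by blast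
  then show ?thesis by (simp add: strips_rem_def row_strip_2)
qed

lemma mem_swap_image: "prod.swap c \<in> prod.swap ` S \<longleftrightarrow> c \<in> S"
  by (simp add: inj_image_mem_iff)

lemma mem_vstrips_add: "c \<in> vstrips_add S \<longleftrightarrow> c \<notin> S \<and> below c \<notin> S \<and> diagram (insert (below c) (insert c S))"
proof -
  have "right (prod.swap c) = prod.swap (below c)" by (simp add: right_def below_def)
  moreover have "c \<in> vstrips_add S \<longleftrightarrow> prod.swap c \<in> strips_add 2 (prod.swap ` S)"
    using mem_swap_image[of "prod.swap c" "strips_add 2 (prod.swap ` S)"] by (simp add: vstrips_add_def)
  moreover have "insert (prod.swap (below c)) (insert (prod.swap c) (prod.swap ` S)) =
      prod.swap ` insert (below c) (insert c S)" by simp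
  ultimately show ?thesis by (simp only: mem_strips_add_2 mem_swap_image diagram_swap_iff)
qed

lemma mem_vstrips_rem: "c \<in> vstrips_rem S \<longleftrightarrow> c \<in> S \<and> below c \<in> S \<and> diagram (S - {below c} - {c})"
proof -
  have "right (prod.swap c) = prod.swap (below c)" by (simp add: right_def below_def)
  moreover have "c \<in> vstrips_rem S \<longleftrightarrow> prod.swap c \<in> strips_rem 2 (prod.swap ` S)"
    using mem_swap_image[of "prod.swap c" "strips_rem 2 (prod.swap ` S)"] by (simp add: vstrips_rem_def)
  moreover have "prod.swap ` S - {prod.swap (below c)} - {prod.swap c} =
      prod.swap ` (S - {below c} - {c})" by (simp add: image_set_diff)
  ultimately show ?thesis by (simp only: mem_strips_rem_2 mem_swap_image diagram_swap_iff)
qed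

lemma sum_vstrips_add:
  fixes f :: "nat \<Rightarrow> 'b::comm_monoid_add"
  assumes "diagram S"
  shows "(\<Sum>c\<in>vstrips_add S. f (snd c)) = f 1 + (\<Sum>c\<in>vstrips_rem S. f (Suc (snd c)))"
  using sum_strips_add[OF diagram_swap[OF assms], of 2 f]
  by (simp add: vstrips_add_def vstrips_rem_def sum.reindex)

text \<open>If \<open>d\<close> were not to the lower right of \<open>c\<close>, leaving out
  \<open>c\<close> would preserve down-closure and \<open>d\<close> could be added at once. No cell
  of \<open>S\<close> lies to the lower right of \<open>c\<close>, so the rectangle from
  \<open>c\<close> to \<open>d\<close> consists of these two cells only.\<close>

lemma not_addable_adjacent:
  assumes S: "diagram S" and c: "c \<notin> S" "diagram (insert c S)"
    and d: "d \<notin> S" "d \<noteq> c" "diagram (insert d (insert c S))" and nd: "\<not> diagram (insert d S)"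
  shows "d = right c \<or> d = below c"
proof -
  obtain i j i' j' where ij: "c = (i, j)" "d = (i', j')" by (cases c, cases d)
  have pos: "1 \<le> i" "1 \<le> j" "1 \<le> i'" "1 \<le> j'"
    using diagram_pos[OF d(3), of i j] diagram_pos[OF d(3), of i' j'] ij by auto
  have out: "(a, b) \<notin> S" if "i \<le> a" "j \<le> b" for a b
    using diagramD[OF S, of a b i j] that pos c ij by blast
  have "i \<le> i' \<and> j \<le> j'"
  proof (rule ccontr)
    assume n: "\<not> (i \<le> i' \<and> j \<le> j')"
    have "diagram (insert d S)"
      unfolding diagram_def
    proof (intro conjI allI impI)
      show "finite (insert d S)" using diagram_finite[OF S] by simp
      show "insert d S \<subseteq> {1..} \<times> {1..}" using diagram_pos[OF S] pos ij by auto
      fix a b a' b' assume a: "(a', b') \<in> insert d S" "1 \<le> a" "a \<le> a'" "1 \<le> b" "b \<le> b'"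
      have "(a, b) \<in> insert d (insert c S)" using diagramD[OF d(3), of a' b' a b] a by blast
      moreover have "(a, b) \<noteq> c"
      proof
        assume "(a, b) = c"
        then have "i \<le> a'" "j \<le> b'" using a ij by auto
        then show False using a(1) out[of a' b'] n ij by auto
      qed
      ultimately show "(a, b) \<in> insert d S" by blast
    qed
    then show False using nd by blast
  qed
  then have le: "i \<le> i'" "j \<le> j'" by auto
  have blk: "(a, b) = c \<or> (a, b) = d" if "i \<le> a" "a \<le> i'" "j \<le> b" "b \<le> j'" for a b
    using diagramD[OF d(3), of i' j' a b] out[of a b] that pos ij by auto
  show ?thesis
  proof (cases "i' = i")
    case True
    then have "Suc j \<le> j'" using d(2) le ij by (cases "j' = j") auto
    then show ?thesis using blk[of i "Suc j"] True ij by (auto simp: right_def)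
  next
    case False
    then have "Suc i \<le> i'" using le by auto
    then show ?thesis using blk[of "Suc i" j] False le ij by (auto simp: below_def)
  qed
qed

text \<open>The row of \<open>c\<close> has no cell of \<open>S\<close> from column
  \<open>snd c\<close> on, so \<open>c\<close> and \<open>right c\<close> are followed by the same
  cells and the two signs agree.\<close>

lemma pos_sign_right:
  assumes S: "diagram S" and c: "c \<notin> S" "1 \<le> fst c" "1 \<le> snd c"
  shows "pos_sign S c * pos_sign (insert c S) (right c) = 1"
proof -
  have "b \<notin> S" if "fst b = fst c" "snd c \<le> snd b" for b
    using diagramD[OF S, of "fst b" "snd b" "fst c" "snd c"] that c by (simp add: prod_eq_iff) (metis prod.collapse)
  then have "{b \<in> insert c S. right c \<lhd> b} = {b \<in> S. c \<lhd> b}"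
    using c by (auto simp: cell_less_def right_def)
  then show ?thesis using pos_sign_square[of S c] by (simp add: pos_sign_def)
qed

text \<open>The cells of \<open>S\<close> between \<open>c\<close> and \<open>below c\<close> in
  reading order are those of the lower row to the left of \<open>below c\<close>. There are
  \<open>snd c - 1\<close> of them, a number of the same parity as
  \<open>Suc (snd c)\<close>.\<close>

lemma pos_sign_below:
  assumes S: "diagram S" and c: "c \<notin> S" "below c \<notin> S" "1 \<le> fst c" "1 \<le> snd c"
    and ins: "diagram (insert (below c) (insert c S))"
  shows "pos_sign S c * pos_sign (insert c S) (below c) = (- 1) ^ Suc (snd c)"
proof -
  obtain i j where ij: "c = (i, j)" by (cases c)
  have pos: "1 \<le> i" "1 \<le> j" using c ij by auto
  have row1: "(i, b) \<notin> S" if "j \<le> b" for b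
    using diagramD[OF S, of i b i j] that c ij by auto
  have row2: "(Suc i, b) \<in> S \<longleftrightarrow> 1 \<le> b \<and> b < j" for b
  proof
    assume b: "(Suc i, b) \<in> S"
    then have "1 \<le> b" using diagram_pos[OF S] by blast
    moreover have "b < j"
    proof (rule ccontr)
      assume "\<not> b < j"
      then have "(Suc i, j) \<in> S" using diagramD[OF S b, of "Suc i" j] pos by auto
      then show False using c ij by (simp add: below_def)
    qed
    ultimately show "1 \<le> b \<and> b < j" by blast
  next
    assume b: "1 \<le> b \<and> b < j"
    then show "(Suc i, b) \<in> S"
      using diagramD[OF ins, of "Suc i" j "Suc i" b] ij by (auto simp: below_def)
  qed
  have "{b \<in> S. c \<lhd> b} = {b \<in> insert c S. below c \<lhd> b} \<union> Pair (Suc i) ` {1..<j}"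
  proof (intro set_eqI)
    fix e :: cell
    obtain a b where e: "e = (a, b)" by (cases e)
    consider "a < i" | "a = i" | "a = Suc i" | "Suc i < a" by linarith
    then show "e \<in> {b \<in> S. c \<lhd> b} \<longleftrightarrow>
        e \<in> {b \<in> insert c S. below c \<lhd> b} \<union> Pair (Suc i) ` {1..<j}"
      using row1[of b] row2[of b] by cases (auto simp: e ij below_def cell_less_def)
  qed
  moreover have "{b \<in> insert c S. below c \<lhd> b} \<inter> Pair (Suc i) ` {1..<j} = {}"
    using ij by (auto simp: below_def cell_less_def)
  moreover have "finite {b \<in> insert c S. below c \<lhd> b}" using diagram_finite[OF S] by simp
  ultimately have "card {b \<in> S. c \<lhd> b} = card {b \<in> insert c S. below c \<lhd> b} + (j - 1)"
    by (simp add: card_Un_disjoint card_image inj_on_def)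
  then have "pos_sign S c = pos_sign (insert c S) (below c) * (- 1) ^ (j - 1)"
    by (simp add: pos_sign_def power_add)
  then have "pos_sign S c * pos_sign (insert c S) (below c) = (- 1) ^ (j - 1)"
    using pos_sign_square[of "insert c S" "below c"] by (simp add: mult_ac)
  moreover have "(- 1 :: int) ^ Suc j = (- 1) ^ (j - 1)" using pos by (cases j) auto
  ultimately show ?thesis using ij by simp
qed

text \<open>Interchanging the two summations turns the sum into its negative, so it vanishes in
  characteristic 0.\<close>

lemma sum_antisymmetric_pairs:
  fixes G :: "'b \<Rightarrow> 'b \<Rightarrow> 'a::field_char_0"
  assumes fin: "finite A" and anti: "\<And>c d. c \<in> A \<Longrightarrow> d \<in> A \<Longrightarrow> c \<noteq> d \<Longrightarrow> G d c = - G c d"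
  shows "(\<Sum>c\<in>A. \<Sum>d\<in>A - {c}. G c d) = 0"
proof -
  let ?s = "\<Sum>c\<in>A. \<Sum>d | d \<in> A \<and> c \<noteq> d. G c d"
  have "?s = (\<Sum>d\<in>A. \<Sum>c | c \<in> A \<and> c \<noteq> d. G c d)" by (rule sum.swap_restrict[OF fin fin])
  also have "\<dots> = (\<Sum>d\<in>A. \<Sum>c | c \<in> A \<and> d \<noteq> c. - G d c)"
    using anti by (intro sum.cong refl) auto
  also have "\<dots> = - ?s" by (simp add: sum_negf)
  finally have "?s = 0" by (simp add: eq_neg_iff_add_eq_0 flip: mult_2)
  moreover have "A - {c} = {d. d \<in> A \<and> c \<noteq> d}" for c by blast
  ultimately show ?thesis by simp
qed

lemma diagram_insert_right:
  assumes S: "diagram S" and d: "diagram (insert (right c) (insert c S))"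
  shows "diagram (insert c S)"
  unfolding diagram_def
proof (intro conjI allI impI)
  show "finite (insert c S)" using diagram_finite[OF S] by simp
  show "insert c S \<subseteq> {1..} \<times> {1..}" using d by (auto simp: diagram_def)
  fix a b a' b' assume a: "(a', b') \<in> insert c S" "1 \<le> a" "a \<le> a'" "1 \<le> b" "b \<le> b'"
  show "(a, b) \<in> insert c S"
  proof (cases "(a', b') \<in> S")
    case True
    then show ?thesis using diagramD[OF S True, of a b] a by blast
  next
    case False
    then have "(a, b) \<noteq> right c" using a by (auto simp: right_def)
    then show ?thesis using diagramD[OF d, of a' b' a b] a by blast
  qed
qed

lemma diagram_insert_below:
  assumes S: "diagram S" and d: "diagram (insert (below c) (insert c S))"
  shows "diagram (insert c S)"
proof -
  have "right (prod.swap c) = prod.swap (below c)" by (simp add: right_def below_def)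
  then have "diagram (insert (right (prod.swap c)) (insert (prod.swap c) (prod.swap ` S)))"
    using diagram_swap[OF d] by simp
  then have "diagram (prod.swap ` insert c S)"
    using diagram_insert_right[OF diagram_swap[OF S]] by simp
  then show ?thesis by (simp only: diagram_swap_iff)
qed

lemma right_neq: "right c \<noteq> c" "c \<noteq> right c" by (auto simp: right_def prod_eq_iff)
lemma below_neq: "below c \<noteq> c" "c \<noteq> below c" by (auto simp: below_def prod_eq_iff)
lemma right_neq_below: "right c \<noteq> below c" by (auto simp: right_def below_def)

text \<open>Old addable cells stay addable because the union of two diagrams is a diagram. New ones
  are adjacent to \<open>c\<close> by \<open>not_addable_adjacent\<close>, and they complete a
  domino.\<close>

lemma addable_insert:
  assumes S: "diagram S" and c: "c \<in> addable S"
  shows "addable (insert c S) = (addable S - {c}) \<union>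
    ((if c \<in> strips_add 2 S then {right c} else {}) \<union> (if c \<in> vstrips_add S then {below c} else {}))"
proof (intro set_eqI iffI)
  have cS: "c \<notin> S" "diagram (insert c S)" using c by (auto simp: addable_def)
  fix d
  {
    assume "d \<in> addable (insert c S)"
    then have d: "d \<notin> S" "d \<noteq> c" "diagram (insert d (insert c S))" by (auto simp: addable_def)
    show "d \<in> (addable S - {c}) \<union>
      ((if c \<in> strips_add 2 S then {right c} else {}) \<union> (if c \<in> vstrips_add S then {below c} else {}))"
    proof (cases "diagram (insert d S)")
      case True
      then show ?thesis using d by (simp add: addable_def)
    next
      case False
      from not_addable_adjacent[OF S cS d False] show ?thesis
        using d cS by (auto simp: mem_strips_add_2 mem_vstrips_add)
    qed
  next
    assume "d \<in> (addable S - {c}) \<union>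
      ((if c \<in> strips_add 2 S then {right c} else {}) \<union> (if c \<in> vstrips_add S then {below c} else {}))"
    moreover have "d \<in> addable (insert c S)" if "d \<in> addable S - {c}"
    proof -
      have "insert c S \<union> insert d S = insert d (insert c S)" by blast
      then show ?thesis using diagram_Un[OF cS(2), of "insert d S"] that by (auto simp: addable_def)
    qed
    ultimately show "d \<in> addable (insert c S)"
      using right_neq[of c] below_neq[of c]
      by (auto simp: mem_strips_add_2 mem_vstrips_add addable_def split: if_splits)
  }
qed

lemma removable_remove:
  assumes S: "diagram S" and c: "c \<in> removable S"
  shows "removable (S - {c}) = (removable S - {c}) \<union>
    ({d \<in> strips_rem 2 S. right d = c} \<union> {d \<in> vstrips_rem S. below d = c})"
proof (intro set_eqI iffI)
  have cS: "c \<in> S" "diagram (S - {c})" using c by (auto simp: removable_def)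
  fix d
  {
    assume "d \<in> removable (S - {c})"
    then have d: "d \<in> S" "d \<noteq> c" "diagram (S - {c} - {d})" by (auto simp: removable_def)
    show "d \<in> (removable S - {c}) \<union>
      ({d \<in> strips_rem 2 S. right d = c} \<union> {d \<in> vstrips_rem S. below d = c})"
    proof (cases "diagram (S - {d})")
      case True
      then show ?thesis using d by (simp add: removable_def)
    next
      case False
      \<comment> \<open>\<open>S\<close> arises from \<open>S - {c} - {d}\<close> by adding
        \<open>d\<close> and then \<open>c\<close>, so \<open>not_addable_adjacent\<close> applies
        with the roles of \<open>c\<close> and \<open>d\<close> exchanged.\<close>
      have eq: "insert d (S - {c} - {d}) = S - {c}" "insert c (S - {c} - {d}) = S - {d}"
        "insert c (insert d (S - {c} - {d})) = S" using d cS by blast+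
      have "c = right d \<or> c = below d"
        by (rule not_addable_adjacent[of "S - {c} - {d}"]) (use d cS False S eq in auto)
      then show ?thesis
        using d cS by (auto simp: mem_strips_rem_2 mem_vstrips_rem)
    qed
  next
    assume "d \<in> (removable S - {c}) \<union>
      ({d \<in> strips_rem 2 S. right d = c} \<union> {d \<in> vstrips_rem S. below d = c})"
    moreover have "d \<in> removable (S - {c})" if "d \<in> removable S - {c}"
    proof -
      have "(S - {c}) \<inter> (S - {d}) = S - {c} - {d}" by blast
      then show ?thesis using diagram_Int[OF cS(2), of "S - {d}"] that by (auto simp: removable_def)
    qed
    ultimately show "d \<in> removable (S - {c})"
      using right_neq[of d] below_neq[of d] by (auto simp: mem_strips_rem_2 mem_vstrips_rem removable_def)
  }
qed

lemma finite_vstrips: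
  assumes "diagram S" shows "finite (vstrips_add S)" "finite (vstrips_rem S)"
  using finite_strips_add[OF diagram_swap[OF assms]] finite_strips_rem[OF diagram_swap[OF assms]]
  by (simp_all add: vstrips_add_def vstrips_rem_def)

text \<open>Two different cells addable to \<open>S\<close> can be added in either order, with
  opposite signs, and cancel. There remain the pairs whose second cell becomes addable only through
  the first: dominoes, built from their left or upper cell.\<close>

lemma up_up_one:
  fixes w :: "cell \<Rightarrow> 'a::field_char_0"
  assumes S: "diagram S"
  shows "up_op w (up_op w (\<lambda>_. 1)) S = (\<Sum>c\<in>strips_add 2 S. w c * w (right c)) +
    (\<Sum>c\<in>vstrips_add S. (- 1) ^ Suc (snd c) * (w c * w (below c)))"
proof -
  define G where "G c d = of_int (pos_sign S c * pos_sign (insert c S) d) * (w c * w d)" for c d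
  have fin: "finite S" "finite (addable S)" using diagram_finite[OF S] finite_addable[OF S] by auto
  have H: "strips_add 2 S \<subseteq> addable S" "vstrips_add S \<subseteq> addable S"
    using diagram_insert_right[OF S] diagram_insert_below[OF S]
    by (auto simp: addable_def mem_strips_add_2 mem_vstrips_add)
  \<comment> \<open>This keeps the domino terms apart from the cancelling pairs: the union in
    \<open>addable_insert\<close> is disjoint.\<close>
  have notadd: "right c \<notin> addable S" "below c \<notin> addable S" if "c \<in> addable S" for c
  proof -
    have c: "c \<notin> S" "diagram (insert c S)" using that by (auto simp: addable_def)
    then have pos: "1 \<le> fst c" "1 \<le> snd c" using diagram_pos[of "insert c S" "fst c" "snd c"] by auto
    show "right c \<notin> addable S"
      using diagramD[of "insert (right c) S" "fst c" "Suc (snd c)" "fst c" "snd c"] c pos right_neq[of c]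
      by (auto simp: addable_def right_def)
    show "below c \<notin> addable S"
      using diagramD[of "insert (below c) S" "Suc (fst c)" "snd c" "fst c" "snd c"] c pos below_neq[of c]
      by (auto simp: addable_def below_def)
  qed
  have "up_op w (up_op w (\<lambda>_. 1)) S = (\<Sum>c\<in>addable S. \<Sum>d\<in>addable (insert c S). G c d)"
    by (simp add: up_op_def G_def sum_distrib_left mult_ac)
  also have "\<dots> = (\<Sum>c\<in>addable S. (\<Sum>d\<in>addable S - {c}. G c d) +
      ((if c \<in> strips_add 2 S then G c (right c) else 0) + (if c \<in> vstrips_add S then G c (below c) else 0)))"
  proof (rule sum.cong[OF refl])
    fix c assume c: "c \<in> addable S"
    let ?X = "if c \<in> strips_add 2 S then {right c} else {}"
    let ?Y = "if c \<in> vstrips_add S then {below c} else {}"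
    have "(\<Sum>d\<in>addable (insert c S). G c d) = (\<Sum>d\<in>addable S - {c}. G c d) + (\<Sum>d\<in>?X \<union> ?Y. G c d)"
      unfolding addable_insert[OF S c] using fin notadd[OF c] by (intro sum.union_disjoint) auto
    also have "(\<Sum>d\<in>?X \<union> ?Y. G c d) = (\<Sum>d\<in>?X. G c d) + (\<Sum>d\<in>?Y. G c d)"
      using right_neq_below[of c] by (intro sum.union_disjoint) auto
    finally show "(\<Sum>d\<in>addable (insert c S). G c d) = (\<Sum>d\<in>addable S - {c}. G c d) +
      ((if c \<in> strips_add 2 S then G c (right c) else 0) + (if c \<in> vstrips_add S then G c (below c) else 0))"
      by simp
  qed
  also have "\<dots> = (\<Sum>c\<in>addable S. \<Sum>d\<in>addable S - {c}. G c d) +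
      ((\<Sum>c\<in>strips_add 2 S. G c (right c)) + (\<Sum>c\<in>vstrips_add S. G c (below c)))"
    using fin(2) H by (simp add: sum.distrib Int_absorb1 flip: sum.inter_restrict)
  also have "(\<Sum>c\<in>addable S. \<Sum>d\<in>addable S - {c}. G c d) = 0"
  proof (rule sum_antisymmetric_pairs[OF fin(2)])
    fix c d assume "c \<in> addable S" "d \<in> addable S" "c \<noteq> d"
    then have "pos_sign S d * pos_sign (insert d S) c = - (pos_sign S c * pos_sign (insert c S) d)"
      using fin cell_less_total[of c d] by (auto simp: addable_def pos_sign_insert)
    then show "G d c = - G c d" unfolding G_def by (simp add: mult_ac)
  qed
  also have "(\<Sum>c\<in>strips_add 2 S. G c (right c)) = (\<Sum>c\<in>strips_add 2 S. w c * w (right c))"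
  proof (rule sum.cong[OF refl])
    fix c assume c: "c \<in> strips_add 2 S"
    then have "c \<notin> S" "1 \<le> fst c" "1 \<le> snd c"
      using diagram_pos[of "insert (right c) (insert c S)" "fst c" "snd c"] by (auto simp: mem_strips_add_2)
    from pos_sign_right[OF S this] show "G c (right c) = w c * w (right c)"
      unfolding G_def by (simp only: of_int_1 mult_1_left)
  qed
  also have "(\<Sum>c\<in>vstrips_add S. G c (below c)) =
      (\<Sum>c\<in>vstrips_add S. (- 1) ^ Suc (snd c) * (w c * w (below c)))"
  proof (rule sum.cong[OF refl])
    fix c assume c: "c \<in> vstrips_add S"
    then have "c \<notin> S" "below c \<notin> S" "1 \<le> fst c" "1 \<le> snd c" "diagram (insert (below c) (insert c S))"
      using diagram_pos[of "insert (below c) (insert c S)" "fst c" "snd c"] by (auto simp: mem_vstrips_add)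
    from pos_sign_below[OF S this] show "G c (below c) = (- 1) ^ Suc (snd c) * (w c * w (below c))"
      unfolding G_def by (simp only: of_int_power of_int_minus of_int_1)
  qed
  finally show ?thesis by simp
qed

text \<open>The cancellation is that of \<open>up_up_one\<close>, but now the right or lower cell of
  a domino goes first.\<close>

lemma down_down_one:
  fixes w :: "cell \<Rightarrow> 'a::field_char_0"
  assumes S: "diagram S"
  shows "down_op w (down_op w (\<lambda>_. 1)) S = (\<Sum>c\<in>strips_rem 2 S. w c * w (right c)) +
    (\<Sum>c\<in>vstrips_rem S. (- 1) ^ Suc (snd c) * (w c * w (below c)))"
proof -
  define G where "G c d = of_int (pos_sign (S - {c}) c * pos_sign (S - {c} - {d}) d) * (w c * w d)" for c d
  have fin: "finite S" "finite (removable S)" "finite (strips_rem 2 S)" "finite (vstrips_rem S)"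
    using diagram_finite[OF S] finite_removable[OF S] finite_strips_rem[OF S, of 2] finite_vstrips[OF S] by auto
  have eqH: "S - {right c} = insert c (S - {right c} - {c})" "S = insert (right c) (insert c (S - {right c} - {c}))"
    "diagram (S - {right c} - {c})" if "c \<in> strips_rem 2 S" for c
    using that right_neq[of c] by (auto simp: mem_strips_rem_2)
  have eqV: "S - {below c} = insert c (S - {below c} - {c})" "S = insert (below c) (insert c (S - {below c} - {c}))"
    "diagram (S - {below c} - {c})" if "c \<in> vstrips_rem S" for c
    using that below_neq[of c] by (auto simp: mem_vstrips_rem)
  have H: "right ` strips_rem 2 S \<subseteq> removable S"
  proof (rule image_subsetI)
    fix c assume c: "c \<in> strips_rem 2 S"
    have "diagram (insert c (S - {right c} - {c}))"
      using diagram_insert_right[OF eqH(3)[OF c]] eqH(2)[OF c] S by metis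
    then show "right c \<in> removable S" using eqH(1)[OF c] c by (simp add: removable_def mem_strips_rem_2)
  qed
  have V: "below ` vstrips_rem S \<subseteq> removable S"
  proof (rule image_subsetI)
    fix c assume c: "c \<in> vstrips_rem S"
    have "diagram (insert c (S - {below c} - {c}))"
      using diagram_insert_below[OF eqV(3)[OF c]] eqV(2)[OF c] S by metis
    then show "below c \<in> removable S" using eqV(1)[OF c] c by (simp add: removable_def mem_vstrips_rem)
  qed
  have notrem: "d \<notin> removable S" if "d \<in> S" "right d \<in> S \<or> below d \<in> S" for d
  proof
    assume d: "d \<in> removable S"
    have pos: "1 \<le> fst d" "1 \<le> snd d" using diagram_pos[OF S, of "fst d" "snd d"] that by auto
    have "right d \<in> S - {d} \<or> below d \<in> S - {d}" using that right_neq[of d] below_neq[of d] by auto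
    then have "(fst d, snd d) \<in> S - {d}"
      using diagramD[of "S - {d}" "fst d" "Suc (snd d)" "fst d" "snd d"]
        diagramD[of "S - {d}" "Suc (fst d)" "snd d" "fst d" "snd d"] d pos
      unfolding right_def below_def removable_def by force
    then show False by simp
  qed
  have "down_op w (down_op w (\<lambda>_. 1)) S = (\<Sum>c\<in>removable S. \<Sum>d\<in>removable (S - {c}). G c d)"
    by (simp add: down_op_def G_def sum_distrib_left mult_ac)
  also have "\<dots> = (\<Sum>c\<in>removable S. (\<Sum>d\<in>removable S - {c}. G c d) +
      ((\<Sum>d | d \<in> strips_rem 2 S \<and> right d = c. G (right d) d) + (\<Sum>d | d \<in> vstrips_rem S \<and> below d = c. G (below d) d)))"
  proof (rule sum.cong[OF refl])
    fix c assume c: "c \<in> removable S"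
    let ?X = "{d \<in> strips_rem 2 S. right d = c}"
    let ?Y = "{d \<in> vstrips_rem S. below d = c}"
    have "(removable S - {c}) \<inter> (?X \<union> ?Y) = {}"
      using notrem by (auto simp: mem_strips_rem_2 mem_vstrips_rem)
    then have "(\<Sum>d\<in>removable (S - {c}). G c d) = (\<Sum>d\<in>removable S - {c}. G c d) + (\<Sum>d\<in>?X \<union> ?Y. G c d)"
      unfolding removable_remove[OF S c] using fin by (intro sum.union_disjoint) auto
    also have "(\<Sum>d\<in>?X \<union> ?Y. G c d) = (\<Sum>d\<in>?X. G c d) + (\<Sum>d\<in>?Y. G c d)"
      using fin by (intro sum.union_disjoint) (auto simp: right_def below_def mem_strips_rem_2 mem_vstrips_rem)
    also have "(\<Sum>d\<in>?X. G c d) = (\<Sum>d\<in>?X. G (right d) d)" by (intro sum.cong) auto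
    also have "(\<Sum>d\<in>?Y. G c d) = (\<Sum>d\<in>?Y. G (below d) d)" by (intro sum.cong) auto
    finally show "(\<Sum>d\<in>removable (S - {c}). G c d) = (\<Sum>d\<in>removable S - {c}. G c d) +
      ((\<Sum>d\<in>?X. G (right d) d) + (\<Sum>d\<in>?Y. G (below d) d))" .
  qed
  \<comment> \<open>The inner sums run over the dominoes whose first removed cell is
    \<open>c\<close>; \<open>sum.group\<close> joins these fibers into sums indexed by the left or
    upper cell.\<close>
  also have "\<dots> = (\<Sum>c\<in>removable S. \<Sum>d\<in>removable S - {c}. G c d) +
      ((\<Sum>d\<in>strips_rem 2 S. G (right d) d) + (\<Sum>d\<in>vstrips_rem S. G (below d) d))"
    unfolding sum.distrib sum.group[OF fin(3,2) H, of "\<lambda>d. G (right d) d"]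
      sum.group[OF fin(4,2) V, of "\<lambda>d. G (below d) d"] ..
  also have "(\<Sum>c\<in>removable S. \<Sum>d\<in>removable S - {c}. G c d) = 0"
  proof (rule sum_antisymmetric_pairs[OF fin(2)])
    fix c d assume cd: "c \<in> removable S" "d \<in> removable S" "c \<noteq> d"
    define P where "P = S - {c} - {d}"
    have "S - {c} = insert d P" "S - {d} = insert c P" "S - {d} - {c} = P" "c \<notin> P" "d \<notin> P" "finite P"
      using cd fin by (auto simp: P_def removable_def)
    then show "G d c = - G c d"
      unfolding G_def P_def[symmetric] using cd(3) cell_less_total[of c d]
      by (auto simp: pos_sign_insert mult_ac)
  qed
  also have "(\<Sum>d\<in>strips_rem 2 S. G (right d) d) = (\<Sum>c\<in>strips_rem 2 S. w c * w (right c))"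
  proof (rule sum.cong[OF refl])
    fix c assume c: "c \<in> strips_rem 2 S"
    define P where "P = S - {right c} - {c}"
    have P: "S - {right c} = insert c P" "diagram P" "c \<notin> P" using eqH[OF c] by (auto simp: P_def)
    have "1 \<le> fst c" "1 \<le> snd c"
      using diagram_pos[OF S, of "fst c" "snd c"] c by (auto simp: mem_strips_rem_2)
    from pos_sign_right[OF P(2,3) this] show "G (right c) c = w c * w (right c)"
      unfolding G_def P_def[symmetric] unfolding P(1) by (simp add: mult.commute flip: of_int_mult)
  qed
  also have "(\<Sum>d\<in>vstrips_rem S. G (below d) d) =
      (\<Sum>c\<in>vstrips_rem S. (- 1) ^ Suc (snd c) * (w c * w (below c)))"
  proof (rule sum.cong[OF refl])
    fix c assume c: "c \<in> vstrips_rem S"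
    define P where "P = S - {below c} - {c}"
    have P: "S - {below c} = insert c P" "diagram P" "c \<notin> P" "below c \<notin> P"
      "diagram (insert (below c) (insert c P))"
      using eqV[OF c] S by (auto simp: P_def)
    have "1 \<le> fst c" "1 \<le> snd c"
      using diagram_pos[OF S, of "fst c" "snd c"] c by (auto simp: mem_vstrips_rem)
    from pos_sign_below[OF P(2,3,4) this P(5)]
    have "pos_sign (insert c P) (below c) * pos_sign P c = (- 1) ^ Suc (snd c)"
      by (simp only: mult.commute)
    then show "G (below c) c = (- 1) ^ Suc (snd c) * (w c * w (below c))"
      unfolding G_def P_def[symmetric] unfolding P(1)
      by (simp only: of_int_power of_int_minus of_int_1 mult.commute[of "w (below c)" "w c"])
  qed
  finally show ?thesis by simp
qed

subsection \<open>The generating functions\<close>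

text \<open>A weight for each single cell: the monomial of a skew shape is then a product over its
  cells, from which one cell at a time can be split off.\<close>

definition cell_wt :: "'a::field_char_0 \<Rightarrow> 'a \<Rightarrow> 'a \<Rightarrow> cell \<Rightarrow> 'a" where
  "cell_wt x y z c = (if even (fst c) then x else 1) * (if even (snd c) then y else 1) *
     (if even (fst c) \<and> even (snd c) then z else 1)"

lemma prod_cell_wt:
  assumes "finite D"
  shows "prod (cell_wt x y z) D = x ^ v_stat D * y ^ h_stat D * z ^ d_stat D"
proof -
  have *: "(\<Prod>c\<in>D. if P c then u else 1) = u ^ card {c \<in> D. P c}" for u :: 'a and P
    using assms by (simp add: prod.If_cases Int_def)
  have "{(i, j) \<in> D. even i} = {c \<in> D. even (fst c)}" "{(i, j) \<in> D. even j} = {c \<in> D. even (snd c)}"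
    "{(i, j) \<in> D. even i \<and> even j} = {c \<in> D. even (fst c) \<and> even (snd c)}" by auto
  then show ?thesis
    by (simp add: cell_wt_def prod.distrib * v_stat_def h_stat_def d_stat_def)
qed

section \<open>Sums over skew shapes as powers of the operators\<close>

definition plus_sum :: "(cell \<Rightarrow> 'a::field_char_0) \<Rightarrow> nat \<Rightarrow> cell set \<Rightarrow> 'a" where
  "plus_sum w m M = (\<Sum>L | diagram L \<and> M \<subseteq> L \<and> card (L - M) = m. prod w (L - M) * of_int (imb L M))"

definition minus_sum :: "(cell \<Rightarrow> 'a::field_char_0) \<Rightarrow> nat \<Rightarrow> cell set \<Rightarrow> 'a" where
  "minus_sum w m L = (\<Sum>M | diagram M \<and> M \<subseteq> L \<and> card (L - M) = m. prod w (L - M) * of_int (imb L M))"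

lemma sum_partitions_eq_sum_diagrams:
  "(\<Sum>lam | is_partition lam \<and> P (young lam). g (young lam)) = (\<Sum>S | diagram S \<and> P S. g S)"
proof (rule sum.reindex_bij_betw)
  show "bij_betw young {lam. is_partition lam \<and> P (young lam)} {S. diagram S \<and> P S}"
    using bij_betw_young unfolding bij_betw_def inj_on_def by (auto simp: diagram_young dest: young_surj)
qed

lemma F_plus_eq_plus_sum:
  assumes "is_partition alpha"
  shows "F_plus x y z alpha m = plus_sum (cell_wt x y z) m (young alpha)"
proof -
  have "F_plus x y z alpha m =
      (\<Sum>lam | is_partition lam \<and> young alpha \<subseteq> young lam \<and> card (young lam - young alpha) = m.
        prod (cell_wt x y z) (young lam - young alpha) * of_int (imb (young lam) (young alpha)))"
    unfolding F_plus_def skew_def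
    by (intro sum.cong refl) (simp add: prod_cell_wt finite_young sign_imbalance_eq_imb[OF assms])
  then show ?thesis
    unfolding plus_sum_def
    using sum_partitions_eq_sum_diagrams[where P = "\<lambda>L. young alpha \<subseteq> L \<and> card (L - young alpha) = m"] by simp
qed

lemma F_minus_eq_minus_sum:
  "F_minus x y z alpha m =
    minus_sum (cell_wt (inverse (- x)) (inverse y) (inverse z)) m (young alpha)"
proof -
  have "F_minus x y z alpha m =
      (\<Sum>mu | is_partition mu \<and> young mu \<subseteq> young alpha \<and> card (young alpha - young mu) = m.
        prod (cell_wt (inverse (- x)) (inverse y) (inverse z)) (young alpha - young mu)
          * of_int (imb (young alpha) (young mu)))"
    unfolding F_minus_def skew_def
    by (intro sum.cong refl)
      (simp add: prod_cell_wt finite_young sign_imbalance_eq_imb power_int_minus power_inverse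
        del: inverse_minus_eq)
  then show ?thesis
    unfolding minus_sum_def
    using sum_partitions_eq_sum_diagrams[where P = "\<lambda>M. M \<subseteq> young alpha \<and> card (young alpha - M) = m"] by simp
qed

lemma plus_sum_0:
  assumes "diagram M" shows "plus_sum w 0 M = 1"
proof -
  have "{L. diagram L \<and> M \<subseteq> L \<and> card (L - M) = 0} = {M}"
    using assms by (auto dest: diagram_finite)
  then show ?thesis by (simp add: plus_sum_def imb_self)
qed

lemma minus_sum_0:
  assumes "diagram L" shows "minus_sum w 0 L = 1"
proof -
  have "{M. diagram M \<and> M \<subseteq> L \<and> card (L - M) = 0} = {L}"
    using assms by (auto dest: diagram_finite)
  then show ?thesis by (simp add: minus_sum_def imb_self)
qed

text \<open>\<open>imb_remove_min\<close> takes out the cell \<open>d\<close> of the smallest entry;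
  its sign and weight form the coefficient in \<open>up_op\<close>, and what remains is a shape over
  \<open>insert d M\<close>.\<close>

lemma plus_sum_Suc:
  assumes M: "diagram M"
  shows "plus_sum w (Suc m) M = up_op w (plus_sum w m) M"
proof -
  define X where "X = {L. diagram L \<and> M \<subseteq> L \<and> card (L - M) = Suc m}"
  have finM: "finite M" using M by (rule diagram_finite)
  \<comment> \<open>The size of \<open>L\<close> is fixed by \<open>M\<close> and \<open>m\<close>,
    which leaves finitely many diagrams, as the interchange of sums requires.\<close>
  have finX: "finite X"
  proof (rule finite_subset)
    show "X \<subseteq> {L. diagram L \<and> card L = card M + Suc m}"
      unfolding X_def using finM card_Diff_subset[OF finM] card_mono[OF diagram_finite] by fastforce
  qed (rule finite_diagrams_of_card)
  have fiber: "{L. diagram L \<and> insert d M \<subseteq> L \<and> card (L - insert d M) = m} = {L. L \<in> X \<and> d \<in> L}"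
    if d: "d \<in> addable M" for d
  proof -
    have "card (L - M) = Suc (card (L - insert d M))" if "diagram L" "d \<in> L" for L
    proof -
      have "L - M - {d} = L - insert d M" by blast
      then show ?thesis
        using card.remove[of "L - M" d] that d diagram_finite[OF that(1)] by (simp add: addable_def)
    qed
    then show ?thesis unfolding X_def by auto
  qed
  have "plus_sum w (Suc m) M = (\<Sum>L\<in>X. \<Sum>d | d \<in> addable M \<and> d \<in> L.
      prod w (L - M) * of_int (pos_sign M d * imb L (insert d M)))"
    unfolding plus_sum_def X_def[symmetric]
  proof (rule sum.cong[OF refl])
    fix L assume "L \<in> X"
    then have "diagram L" "M \<subset> L" by (auto simp: X_def)
    from imb_remove_min[OF this(1) M this(2)]
    show "prod w (L - M) * of_int (imb L M) = (\<Sum>d | d \<in> addable M \<and> d \<in> L.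
        prod w (L - M) * of_int (pos_sign M d * imb L (insert d M)))"
      by (simp add: Int_def sum_distrib_left)
  qed
  also have "\<dots> = (\<Sum>d\<in>addable M. \<Sum>L | L \<in> X \<and> d \<in> L.
      prod w (L - M) * of_int (pos_sign M d * imb L (insert d M)))"
    by (rule sum.swap_restrict[OF finX finite_addable[OF M]])
  also have "\<dots> = (\<Sum>d\<in>addable M. of_int (pos_sign M d) * w d * plus_sum w m (insert d M))"
  proof (rule sum.cong[OF refl])
    fix d assume d: "d \<in> addable M"
    have "prod w (L - M) = w d * prod w (L - insert d M)" if "L \<in> X" "d \<in> L" for L
    proof -
      have "L - M - {d} = L - insert d M" by blast
      then show ?thesis
        using prod.remove[of "L - M" d w] that d by (auto simp: addable_def X_def dest: diagram_finite)
    qed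
    then show "(\<Sum>L | L \<in> X \<and> d \<in> L. prod w (L - M) * of_int (pos_sign M d * imb L (insert d M))) =
        of_int (pos_sign M d) * w d * plus_sum w m (insert d M)"
      unfolding plus_sum_def fiber[OF d] sum_distrib_left by (intro sum.cong refl) (simp add: mult_ac)
  qed
  finally show ?thesis by (simp add: up_op_def)
qed

text \<open>Dual to \<open>plus_sum_Suc\<close>: the outer shape shrinks, so the largest entry is
  taken out, by \<open>imb_remove_max\<close>.\<close>

lemma minus_sum_Suc:
  assumes L: "diagram L"
  shows "minus_sum w (Suc m) L = down_op w (minus_sum w m) L"
proof -
  define X where "X = {M. diagram M \<and> M \<subseteq> L \<and> card (L - M) = Suc m}"
  have finL: "finite L" using L by (rule diagram_finite)
  have finX: "finite X"
    by (rule finite_subset[of _ "Pow L"]) (use finL in \<open>auto simp: X_def\<close>)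
  have fiber: "{M. diagram M \<and> M \<subseteq> L - {c} \<and> card (L - {c} - M) = m} = {M. M \<in> X \<and> c \<notin> M}"
    if c: "c \<in> removable L" for c
  proof -
    have "card (L - M) = Suc (card (L - {c} - M))" if "c \<notin> M" for M
    proof -
      have "L - M - {c} = L - {c} - M" by blast
      then show ?thesis
        using card.remove[of "L - M" c] that c finL by (simp add: removable_def)
    qed
    then show ?thesis unfolding X_def by auto
  qed
  have "minus_sum w (Suc m) L = (\<Sum>M\<in>X. \<Sum>c | c \<in> removable L \<and> c \<notin> M.
      prod w (L - M) * of_int (pos_sign (L - {c}) c * imb (L - {c}) M))"
    unfolding minus_sum_def X_def[symmetric]
  proof (rule sum.cong[OF refl])
    fix M assume "M \<in> X"
    then have "diagram M" "M \<subset> L" by (auto simp: X_def)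
    from imb_remove_max[OF L this]
    show "prod w (L - M) * of_int (imb L M) = (\<Sum>c | c \<in> removable L \<and> c \<notin> M.
        prod w (L - M) * of_int (pos_sign (L - {c}) c * imb (L - {c}) M))"
      by (simp add: set_diff_eq sum_distrib_left)
  qed
  also have "\<dots> = (\<Sum>c\<in>removable L. \<Sum>M | M \<in> X \<and> c \<notin> M.
      prod w (L - M) * of_int (pos_sign (L - {c}) c * imb (L - {c}) M))"
    by (rule sum.swap_restrict[OF finX finite_removable[OF L]])
  also have "\<dots> = (\<Sum>c\<in>removable L. of_int (pos_sign (L - {c}) c) * w c * minus_sum w m (L - {c}))"
  proof (rule sum.cong[OF refl])
    fix c assume c: "c \<in> removable L"
    have "prod w (L - M) = w c * prod w (L - {c} - M)" if "c \<notin> M" for M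
    proof -
      have "L - M - {c} = L - {c} - M" by blast
      then show ?thesis
        using prod.remove[of "L - M" c w] that c finL by (simp add: removable_def)
    qed
    then show "(\<Sum>M | M \<in> X \<and> c \<notin> M. prod w (L - M) * of_int (pos_sign (L - {c}) c * imb (L - {c}) M)) =
        of_int (pos_sign (L - {c}) c) * w c * minus_sum w m (L - {c})"
      unfolding minus_sum_def fiber[OF c] sum_distrib_left by (intro sum.cong refl) (simp add: mult_ac)
  qed
  finally show ?thesis by (simp add: down_op_def)
qed

lemma plus_sum_funpow: "diagram M \<Longrightarrow> plus_sum w m M = (up_op w ^^ m) (\<lambda>_. 1) M"
proof (induction m arbitrary: M)
  case 0
  then show ?case by (simp add: plus_sum_0)
next
  case (Suc m)
  then show ?case by (simp add: plus_sum_Suc cong: up_op_cong)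
qed

lemma minus_sum_funpow: "diagram M \<Longrightarrow> minus_sum w m M = (down_op w ^^ m) (\<lambda>_. 1) M"
proof (induction m arbitrary: M)
  case 0
  then show ?case by (simp add: minus_sum_0)
next
  case (Suc m)
  then show ?case by (simp add: minus_sum_Suc cong: down_op_cong)
qed

section \<open>From two steps to the binomial identity\<close>

lemma up_up_one_eq:
  fixes x y z :: "'a::field_char_0"
  assumes S: "diagram S" and nz: "x \<noteq> 0" "y \<noteq> 0" "z \<noteq> 0"
  defines "w \<equiv> cell_wt x y z" and "w' \<equiv> cell_wt (inverse (- x)) (inverse y) (inverse z)"
  shows "up_op w (up_op w (\<lambda>_. 1)) S =
    (x\<^sup>2 * y\<^sup>2 * z) * down_op w' (down_op w' (\<lambda>_. 1)) S + (x + y)"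
proof -
  \<comment> \<open>The factor \<open>q\<close> is such that \<open>q\<close> times the
    \<open>w'\<close>-weight of a domino in one row (or column) is the \<open>w\<close>-weight of a
    domino in the next one, signs included.\<close>
  define q where "q = x\<^sup>2 * y\<^sup>2 * z"
  \<comment> \<open>A horizontal domino meets columns of both parities, so its weight depends only
    on the parity of its row. Likewise \<open>g\<close> depends only on the column; it includes the
    sign of a vertical domino.\<close>
  define h where "h i = (if even i then x\<^sup>2 * y * z else y)" for i :: nat
  define g where "g j = (if even j then - (x * y\<^sup>2 * z) else x)" for j :: nat
  have h: "w c * w (right c) = h (fst c)" "q * (w' c * w' (right c)) = h (Suc (fst c))" for c
    using nz by (auto simp: w_def w'_def cell_wt_def right_def h_def q_def field_simps power2_eq_square)
  \<comment> \<open>The \<open>- x\<close> in \<open>w'\<close> makes up for the change of sign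
    between neighbouring columns.\<close>
  have g: "(- 1) ^ Suc (snd c) * (w c * w (below c)) = g (snd c)"
    "q * ((- 1) ^ Suc (snd c) * (w' c * w' (below c))) = g (Suc (snd c))" for c
    using nz by (auto simp: w_def w'_def cell_wt_def below_def g_def q_def field_simps power2_eq_square)
  have "up_op w (up_op w (\<lambda>_. 1)) S =
      (\<Sum>c\<in>strips_add 2 S. h (fst c)) + (\<Sum>c\<in>vstrips_add S. g (snd c))"
    unfolding up_up_one[OF S] h g ..
  \<comment> \<open>Telescoping leaves the terms of row 1 and column 1, which are
    \<open>h 1 = y\<close> and \<open>g 1 = x\<close>.\<close>
  also have "\<dots> = (h 1 + (\<Sum>c\<in>strips_rem 2 S. h (Suc (fst c)))) +
      (g 1 + (\<Sum>c\<in>vstrips_rem S. g (Suc (snd c))))"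
    using sum_strips_add[OF S, of 2 h] sum_vstrips_add[OF S, of g] by simp
  also have "\<dots> = q * down_op w' (down_op w' (\<lambda>_. 1)) S + (x + y)"
    unfolding down_down_one[OF S] distrib_left sum_distrib_left h g by (simp add: h_def g_def)
  finally show ?thesis by (simp add: q_def)
qed

text \<open>Only \<open>- x\<close> carries a sign, and it enters exactly in the even rows.\<close>

lemma cell_wt_inverse:
  assumes "x \<noteq> 0" "y \<noteq> 0" "z \<noteq> 0"
  shows "cell_wt x y z c * cell_wt (inverse (- x)) (inverse y) (inverse z) c = (- 1) ^ Suc (fst c)"
  using assms by (auto simp: cell_wt_def field_simps)

text \<open>The operator relations are proved on diagrams only, so linear relations between
  functions are assumed there only; \<open>cong\<close> carries them through the iteration.\<close>

lemma funpow_diagram_linear: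
  fixes op :: "(cell set \<Rightarrow> 'a::field_char_0) \<Rightarrow> cell set \<Rightarrow> 'a"
  assumes cong: "\<And>f g S. (\<And>T. diagram T \<Longrightarrow> f T = g T) \<Longrightarrow> op f S = op g S"
    and add: "\<And>f g S. op (\<lambda>T. f T + g T) S = op f S + op g S"
    and scale: "\<And>k f S. op (\<lambda>T. k * f T) S = k * op f S"
    and h: "\<And>T. diagram T \<Longrightarrow> h T = a * f T + b * g T"
  shows "diagram S \<Longrightarrow> (op ^^ m) h S = a * (op ^^ m) f S + b * (op ^^ m) g S"
proof (induction m arbitrary: S)
  case 0
  then show ?case by (simp add: h)
next
  case (Suc m)
  have "op ((op ^^ m) h) S = op (\<lambda>T. a * (op ^^ m) f T + b * (op ^^ m) g T) S"
    by (rule cong) (rule Suc.IH)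
  then show ?case by (simp add: add scale)
qed

text \<open>With \<open>E\<close> the shift of \<open>k\<close>, each step in \<open>n\<close>
  applies \<open>E + c\<close>. The solution is the binomial expansion of \<open>(E + c)^n\<close>,
  obtained by Pascal's rule.\<close>

lemma binomial_recurrence_solution:
  fixes b :: "nat \<Rightarrow> nat \<Rightarrow> 'a::comm_ring_1"
  assumes rec: "\<And>n k. b (Suc n) k = b n (Suc k) + c * b n k"
  shows "b n k = (\<Sum>j\<le>n. of_nat (n choose j) * c ^ (n - j) * b 0 (k + j))"
proof (induction n arbitrary: k)
  case 0
  then show ?case by simp
next
  case (Suc n)
  have "c * b n k = (\<Sum>j\<le>n. of_nat (n choose j) * c ^ (Suc n - j) * b 0 (k + j))"
    unfolding Suc.IH sum_distrib_left by (intro sum.cong) (auto simp: Suc_diff_le mult_ac)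
  also have "\<dots> = (\<Sum>j\<le>Suc n. of_nat (n choose j) * c ^ (Suc n - j) * b 0 (k + j))"
    by (simp add: binomial_eq_0)
  also have "\<dots> = c ^ Suc n * b 0 k + (\<Sum>j\<le>n. of_nat (n choose Suc j) * c ^ (n - j) * b 0 (k + Suc j))"
    by (subst sum.atMost_Suc_shift) simp
  finally have "b (Suc n) k = c ^ Suc n * b 0 k + ((\<Sum>j\<le>n. of_nat (n choose j) * c ^ (n - j) * b 0 (k + Suc j)) +
      (\<Sum>j\<le>n. of_nat (n choose Suc j) * c ^ (n - j) * b 0 (k + Suc j)))"
    by (simp add: rec Suc.IH[of "Suc k"])
  also have "\<dots> = c ^ Suc n * b 0 k + (\<Sum>j\<le>n. of_nat (Suc n choose Suc j) * c ^ (n - j) * b 0 (k + Suc j))"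
    by (simp add: distrib_right sum.distrib)
  also have "\<dots> = (\<Sum>j\<le>Suc n. of_nat (Suc n choose j) * c ^ (Suc n - j) * b 0 (k + j))"
    by (subst sum.atMost_Suc_shift) simp
  finally show ?case .
qed

lemma plus_sum_eq_binomial_minus_sum:
  fixes x y z :: "'a::field_char_0"
  assumes S: "diagram S" and nz: "x \<noteq> 0" "y \<noteq> 0" "z \<noteq> 0"
  defines "w \<equiv> cell_wt x y z" and "w' \<equiv> cell_wt (inverse (- x)) (inverse y) (inverse z)"
  shows "plus_sum w (2 * n) S = (\<Sum>j\<le>n. of_nat (n choose j) * (x + y) ^ (n - j) *
    ((x\<^sup>2 * y\<^sup>2 * z) ^ j * minus_sum w' (2 * j) S))"
proof -
  define q where "q = x\<^sup>2 * y\<^sup>2 * z"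
  define one where "one = (\<lambda>_ :: cell set. 1 :: 'a)"
  \<comment> \<open>Mixed powers make the recurrence possible: \<open>b n 0\<close> is the left-hand
    side, \<open>b 0 k\<close> the minus sum with its factor, and one application of
    \<open>U^2\<close> trades a step in \<open>n\<close> for a step in \<open>k\<close>.\<close>
  define b where "b n k = q ^ k * (up_op w ^^ (2 * n)) ((down_op w' ^^ (2 * k)) one) S" for n k
  have up_lin: "(up_op w ^^ m) h T = k * (up_op w ^^ m) f T + l * (up_op w ^^ m) g T"
    if "\<And>T. diagram T \<Longrightarrow> h T = k * f T + l * g T" "diagram T" for f g h k l m T
    by (rule funpow_diagram_linear[OF _ up_op_add up_op_scale that], rule up_op_cong)
  have down_lin: "(down_op w' ^^ m) h T = k * (down_op w' ^^ m) f T + l * (down_op w' ^^ m) g T"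
    if "\<And>T. diagram T \<Longrightarrow> h T = k * f T + l * g T" "diagram T" for f g h k l m T
    by (rule funpow_diagram_linear[OF _ down_op_add down_op_scale that], rule down_op_cong)
  have ww: "w c * w' c = (- 1) ^ Suc (fst c)" for c
    unfolding w_def w'_def by (rule cell_wt_inverse[OF nz])
  have comm: "up_op w (up_op w ((down_op w' ^^ m) f)) T = (down_op w' ^^ m) (up_op w (up_op w f)) T"
    if "diagram T" for m f T
    using that
  proof (induction m arbitrary: T)
    case (Suc m)
    have "up_op w (up_op w (down_op w' ((down_op w' ^^ m) f))) T =
        down_op w' (up_op w (up_op w ((down_op w' ^^ m) f))) T"
      by (rule up_up_down_commute[OF Suc.prems ww])
    also have "\<dots> = down_op w' ((down_op w' ^^ m) (up_op w (up_op w f))) T"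
      by (rule down_op_cong) (rule Suc.IH)
    finally show ?case by simp
  qed simp
  have one: "up_op w (up_op w one) T = q * down_op w' (down_op w' one) T + (x + y) * one T" if "diagram T" for T
    using up_up_one_eq[OF that nz] by (simp add: one_def q_def w_def w'_def)
  \<comment> \<open>\<open>U^2\<close> is moved past all down steps until it meets the constant 1,
    where the relation \<open>one\<close> applies.\<close>
  have step: "up_op w (up_op w ((down_op w' ^^ (2 * k)) one)) T =
      q * (down_op w' ^^ (2 * Suc k)) one T + (x + y) * (down_op w' ^^ (2 * k)) one T" if "diagram T" for k T
  proof -
    have "(down_op w' ^^ (2 * k)) (down_op w' (down_op w' one)) = (down_op w' ^^ (2 * Suc k)) one"
      by (simp add: funpow_swap1)
    moreover have "(down_op w' ^^ (2 * k)) (up_op w (up_op w one)) T =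
        q * (down_op w' ^^ (2 * k)) (down_op w' (down_op w' one)) T + (x + y) * (down_op w' ^^ (2 * k)) one T"
      by (rule down_lin[OF _ that]) (rule one)
    ultimately show ?thesis using comm[OF that, of "2 * k" one] by simp
  qed
  have "b (Suc n) k = b n (Suc k) + (x + y) * b n k" for n k
  proof -
    have "(up_op w ^^ (2 * Suc n)) ((down_op w' ^^ (2 * k)) one) S =
        (up_op w ^^ (2 * n)) (up_op w (up_op w ((down_op w' ^^ (2 * k)) one))) S"
      by (simp add: funpow_swap1)
    also have "\<dots> = q * (up_op w ^^ (2 * n)) ((down_op w' ^^ (2 * Suc k)) one) S +
        (x + y) * (up_op w ^^ (2 * n)) ((down_op w' ^^ (2 * k)) one) S"
      by (rule up_lin[OF _ S]) (rule step)
    finally show ?thesis unfolding b_def by (simp add: algebra_simps)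
  qed
  from binomial_recurrence_solution[of b, OF this, of n 0]
  show ?thesis
    by (simp add: b_def one_def q_def plus_sum_funpow[OF S] minus_sum_funpow[OF S])
qed

theorem theorem4p9:
  fixes x y z :: "'a::field_char_0" and alpha :: "nat list"
  assumes "is_partition alpha" and "x \<noteq> 0" and "y \<noteq> 0" and "z \<noteq> 0"
  shows "Abs_fps (\<lambda>n. F_plus x y z alpha (2 * n) / fact n)
       / Abs_fps (\<lambda>n. F_minus x y z alpha (2 * n) * (x\<^sup>2 * y\<^sup>2 * z) ^ n / fact n)
       = fps_exp (x + y)"
proof -
  define G where "G = Abs_fps (\<lambda>n. F_minus x y z alpha (2 * n) * (x\<^sup>2 * y\<^sup>2 * z) ^ n / fact n)"
  have S: "diagram (young alpha)" using assms(1) by (rule diagram_young)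
  \<comment> \<open>With the quotient multiplied out, the coefficients of the product are binomial
    sums divided by \<open>fact n\<close>.\<close>
  have "Abs_fps (\<lambda>n. F_plus x y z alpha (2 * n) / fact n) = G * fps_exp (x + y)"
  proof (rule fps_ext)
    fix n
    have "fps_nth (G * fps_exp (x + y)) n =
        (\<Sum>j\<le>n. F_minus x y z alpha (2 * j) * (x\<^sup>2 * y\<^sup>2 * z) ^ j / fact j * ((x + y) ^ (n - j) / fact (n - j)))"
      by (simp add: fps_mult_nth G_def atLeast0AtMost)
    also have "\<dots> = (\<Sum>j\<le>n. of_nat (n choose j) * (x + y) ^ (n - j) *
        ((x\<^sup>2 * y\<^sup>2 * z) ^ j * F_minus x y z alpha (2 * j))) / fact n"
      unfolding sum_divide_distrib
      by (intro sum.cong refl) (simp add: binomial_fact field_simps)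
    also have "\<dots> = F_plus x y z alpha (2 * n) / fact n"
      by (simp only: F_plus_eq_plus_sum[OF assms(1)] F_minus_eq_minus_sum
          plus_sum_eq_binomial_minus_sum[OF S assms(2-4)])
    finally show "fps_nth (Abs_fps (\<lambda>n. F_plus x y z alpha (2 * n) / fact n)) n =
        fps_nth (G * fps_exp (x + y)) n" by simp
  qed
  \<comment> \<open>For \<open>n = 0\<close> the only inner shape is that of \<open>alpha\<close>
    itself. Hence \<open>G\<close> is nonzero and cancels from the quotient.\<close>
  moreover have "fps_nth G 0 = 1"
    by (simp add: G_def F_minus_eq_minus_sum minus_sum_0[OF S])
  then have "G \<noteq> 0" by auto
  ultimately show ?thesis unfolding G_def[symmetric] by simp
qed

end
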